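(* If Condition $\mathcal H_\delta(U,V)$ (defined in the context) is satisfied for some $\delta\in(0,1]$, then Condition $\mathcal D_{\varphi,\psi}(S)$ (defined in the context) is satisfied with $n_0=1$ for the functions $$(\varphi,\psi)=\big(e^{\delta(U-U_\star)},e^{\delta(V-V_\star)}\big),\qquad U_\star:=\inf_{\mathbb X}U,\quad V_\star:=\inf_{\mathbb Y}V\in\mathbb R.$$ In addition, there exist $\rho\in[0,1)$ and $c>0$ such that for any $n\ge1$ $$\Big\|\log\frac{d\pi_{2n}}{d\nu_V}\Big\|_\psi\vee\Big\|\log\frac{d\pi_{2n+1}}{d\lambda_U}\Big\|_\varphi\le c\,\rho^{2n}.$$
   Context: Setting. $(\mathbb X,\lambda)$ and $(\mathbb Y,\nu)$ are locally compact Polish spaces with positive measures $\lambda,\nu$ that are finite on compact sets. $U:\mathbb X\to\mathbb R$, $V:\mathbb Y\to\mathbb R$, $W:\mathbb X\times\mathbb Y\to\mathbb R$ are measurable, such that $\lambda_U(dx):=e^{-U(x)}\lambda(dx)$ and $\nu_V(dy):=e^{-V(y)}\nu(dy)$ are probability measures and $Q(x,dy):=e^{-W(x,y)}\nu(dy)$ is a Markov kernel; more generally $\lambda_F(dx)=e^{-F(x)}\lambda(dx)$, $\nu_G(dy)=e^{-G(y)}\nu(dy)$ for any functions $F,G$. Put $R(y,dx):=e^{-W(x,y)}\lambda(dx)$. Integrated costs: $W_U(y)=\int\lambda_U(dx)W(x,y)$, $W^V(x)=\int\nu_V(dy)W(x,y)$. For a kernel $K$, $K(f)(x)=\int K(x,dy)f(y)$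 and $(\mu K)(dy)=\int\mu(dx)K(x,dy)$. Standing assumption: some probability measure with marginals $\lambda_U,\nu_V$ has finite relative entropy with respect to $\lambda_U(dx)Q(x,dy)$. Standing regularity: $U,V,W$ are locally bounded (bounded on compact sets), $e^{-W}\in L_\infty(\lambda\otimes\nu)$, and $U,V$ have compact sub-level sets ($\{U\le r\}$, $\{V\le r\}$ compact for all real $r$). Condition $\mathcal H_\delta(U,V)$: the functions $\mathcal U_\delta=\delta U-W^V$ and $\mathcal V_\delta=\delta V-W_U$ are locally bounded with compact sub-level sets, and $\lambda_{(1-\delta)U}(e^{W^V})\vee\nu_{(1-\delta)V}(e^{W_U})<\infty$. Sinkhorn iterations. $U_0=U$, $V_0=0$, and for $n\ge0$: $U_{2n+1}=U_{2n}=U+\log Q(e^{-V_{2n}})$, $V_{2(n+1)}=V_{2n+1}=V+\log R(e^{-U_{2n}})$; $$S_{2n}(x,dy)=\frac{Q(x,dy)e^{-V_{2n}(y)}}{Q(e^{-V_{2n}})(x)},\qquad S_{2n+1}(y,dx)=\frac{R(y,dx)e^{-U_{2n+1}(x)}}{R(e^{-U_{2n+1}})(y)};$$ $\pi_{2n}=\lambda_US_{2n}$, $\pi_{2n+1}=\nu_VS_{2n+1}$. Condition $\mathcal D_{\varphi,\psi}(S)$ with integer $n_0$, for $\varphi,\psi\ge1$: there exist $\epsilon\in(0,1)$, $c>0$ such that for all $n\ge n_0$, $S_{2n}(\psi)\le\epsilon\varphi+c$ and $S_{2n+1}(\varphi)\le\epsilon\psi+c$; moreover there exist $r_0\ge1$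 and $\varepsilon:[r_0,\infty)\to(0,1]$ such that for any $r\ge r_0$, $x_1,x_2\in\{\varphi\le r\}$, $y_1,y_2\in\{\psi\le r\}$, $n\ge n_0$: $\|(\delta_{x_1}-\delta_{x_2})S_{2n}\|_{tv}\vee\|(\delta_{y_1}-\delta_{y_2})S_{2n+1}\|_{tv}\le1-\varepsilon(r)$, where $\|\mu_1-\mu_2\|_{tv}=\tfrac12|\mu_1-\mu_2|(1)$. $\|f\|_\psi=\sup|f|/\psi$. Pointwise statements are understood up to $\lambda$-, $\nu$-null sets where $W$ is only essentially bounded below. *)

theory Defs
  imports "HOL-Probability.Probability" "HOL-Library.Disjoint_Sets"
begin

definition locally_bounded :: "('a::topological_space \<Rightarrow> real) \<Rightarrow> bool" where
  "locally_bounded f \<longleftrightarrow> (\<forall>K. compact K \<longrightarrow> bounded (f ` K))"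

definition compact_sublevels :: "('a::topological_space \<Rightarrow> real) \<Rightarrow> bool" where
  "compact_sublevels f \<longleftrightarrow> (\<forall>r. compact {x. f x \<le> r})"

definition finite_on_compacts :: "'a::topological_space measure \<Rightarrow> bool" where
  "finite_on_compacts M \<longleftrightarrow> (\<forall>K. compact K \<longrightarrow> emeasure M K < \<infinity>)"

definition gibbs :: "'a measure \<Rightarrow> ('a \<Rightarrow> real) \<Rightarrow> 'a measure" where
  "gibbs M F = density M (\<lambda>x. ennreal (exp (- F x)))"

definition kernel_Q :: "'b measure \<Rightarrow> ('a \<Rightarrow> 'b \<Rightarrow> real) \<Rightarrow> 'a \<Rightarrow> 'b measure" where
  "kernel_Q nu W x = density nu (\<lambda>y. ennreal (exp (- W x y)))"

definition kernel_R :: "'a measure \<Rightarrow> ('a \<Rightarrow> 'b \<Rightarrow> real) \<Rightarrow> 'b \<Rightarrow> 'a measure" where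
  "kernel_R lam W y = density lam (\<lambda>x. ennreal (exp (- W x y)))"

text \<open>The function \<open>K(f)\<close>, for nonnegative \<open>f\<close> only (negative values are cut off); it may be infinite.\<close>

definition kapp :: "('a \<Rightarrow> 'b measure) \<Rightarrow> ('b \<Rightarrow> real) \<Rightarrow> 'a \<Rightarrow> ennreal" where
  "kapp K f x = (\<integral>\<^sup>+ y. ennreal (f y) \<partial>K x)"

text \<open>\<open>M(dx) K(x,dy)\<close>. The measure \<open>MK\<close> itself is \<open>Giry_Monad.bind M K\<close>.\<close>

definition kjoint ::
  "'a::topological_space measure \<Rightarrow> ('a \<Rightarrow> 'b::topological_space measure) \<Rightarrow> ('a \<times> 'b) measure" where
  "kjoint M K = Giry_Monad.bind M (\<lambda>x. distr (K x) (borel \<Otimes>\<^sub>M borel) (Pair x))"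

text \<open>Half the total mass of the variation \<open>|M - N|\<close>, for finite measures on one
  \<open>\<sigma>\<close>-algebra.\<close>

definition tv_dist :: "'a measure \<Rightarrow> 'a measure \<Rightarrow> real" where
  "tv_dist M N = 1/2 * (SUP P \<in> {P. finite P \<and> P \<subseteq> sets M \<and> partition_on (space M) P}.
                          \<Sum>A\<in>P. \<bar>measure M A - measure N A\<bar>)"

text \<open>The relative entropy of \<open>P\<close> with respect to \<open>M\<close> is finite. For probability measures the
  negative part of \<open>log dP/dM\<close> is always \<open>P\<close>-integrable, so that integrability says exactly that
  the entropy is not \<open>\<infinity>\<close>.\<close>

definition finite_rel_entropy :: "'a measure \<Rightarrow> 'a measure \<Rightarrow> bool" where
  "finite_rel_entropy P M \<longleftrightarrow> sets P = sets M \<and> absolutely_continuous M P \<and>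
     integrable P (entropy_density (exp 1) M P)"

definition coupling :: "'a::topological_space measure \<Rightarrow> 'b::topological_space measure
    \<Rightarrow> ('a \<times> 'b) measure \<Rightarrow> bool" where
  "coupling M N P \<longleftrightarrow> prob_space P \<and> sets P = sets (borel \<Otimes>\<^sub>M borel) \<and>
     distr P borel fst = M \<and> distr P borel snd = N"

definition eln :: "ennreal \<Rightarrow> ereal" where
  "eln t = (if t = 0 then -\<infinity> else if t = \<infinity> then \<infinity> else ereal (ln (enn2real t)))"

text \<open>\<open>dP/dM\<close> is determined only up to \<open>M\<close>-null sets, so the weighted supremum norm is an
  essential one.\<close>

definition log_density :: "'a measure \<Rightarrow> 'a measure \<Rightarrow> 'a \<Rightarrow> ereal" where
  "log_density M P x = eln (RN_deriv M P x)"

definition wnorm :: "'a measure \<Rightarrow> ('a \<Rightarrow> real) \<Rightarrow> ('a \<Rightarrow> ereal) \<Rightarrow> ereal" where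
  "wnorm M w f = esssup M (\<lambda>x. \<bar>f x\<bar> / ereal (w x))"

text \<open>\<open>sinkhorn_potentials lam nu U V W m\<close> is the pair \<open>(U\<^sub>m, V\<^sub>m)\<close>. The integrals \<open>R(e\<^sup>-\<^sup>U)\<close>,
  \<open>Q(e\<^sup>-\<^sup>V)\<close> are finite outside null sets; where they are not, \<open>enn2real\<close> gives the value 0.\<close>

primrec sinkhorn_potentials :: "'a measure \<Rightarrow> 'b measure \<Rightarrow> ('a \<Rightarrow> real) \<Rightarrow> ('b \<Rightarrow> real)
    \<Rightarrow> ('a \<Rightarrow> 'b \<Rightarrow> real) \<Rightarrow> nat \<Rightarrow> ('a \<Rightarrow> real) \<times> ('b \<Rightarrow> real)" where
  "sinkhorn_potentials lam nu U V W 0 = (U, \<lambda>y. 0)"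
| "sinkhorn_potentials lam nu U V W (Suc m) =
    (let (u, v) = sinkhorn_potentials lam nu U V W m in
     if even m
     then (u, \<lambda>y. V y + ln (enn2real (kapp (kernel_R lam W) (\<lambda>x. exp (- u x)) y)))
     else (\<lambda>x. U x + ln (enn2real (kapp (kernel_Q nu W) (\<lambda>y. exp (- v y)) x)), v))"

definition pot_U :: "'a measure \<Rightarrow> 'b measure \<Rightarrow> ('a \<Rightarrow> real) \<Rightarrow> ('b \<Rightarrow> real)
    \<Rightarrow> ('a \<Rightarrow> 'b \<Rightarrow> real) \<Rightarrow> nat \<Rightarrow> 'a \<Rightarrow> real" where
  "pot_U lam nu U V W m = fst (sinkhorn_potentials lam nu U V W m)"

definition pot_V :: "'a measure \<Rightarrow> 'b measure \<Rightarrow> ('a \<Rightarrow> real) \<Rightarrow> ('b \<Rightarrow> real)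
    \<Rightarrow> ('a \<Rightarrow> 'b \<Rightarrow> real) \<Rightarrow> nat \<Rightarrow> 'b \<Rightarrow> real" where
  "pot_V lam nu U V W m = snd (sinkhorn_potentials lam nu U V W m)"

lemma pot_V_odd:
  "pot_V lam nu U V W (2*n+1) y =
     V y + ln (enn2real (kapp (kernel_R lam W) (\<lambda>x. exp (- pot_U lam nu U V W (2*n) x)) y))"
  by (simp add: pot_V_def pot_U_def case_prod_beta Let_def)

lemma pot_V_even: "pot_V lam nu U V W (2*(n+1)) = pot_V lam nu U V W (2*n+1)"
  by (simp add: pot_V_def case_prod_beta Let_def)

lemma pot_U_odd: "pot_U lam nu U V W (2*n+1) = pot_U lam nu U V W (2*n)"
  by (simp add: pot_U_def case_prod_beta Let_def)

lemma pot_U_even: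
  assumes "\<And>x. prob_space (kernel_Q nu W x)"
  shows "pot_U lam nu U V W (2*n) x =
     U x + ln (enn2real (kapp (kernel_Q nu W) (\<lambda>y. exp (- pot_V lam nu U V W (2*n) y)) x))"
proof (cases n)
  case 0
  then show ?thesis
    by (simp add: pot_U_def pot_V_def kapp_def prob_space.emeasure_space_1[OF assms])
next
  case (Suc k)
  then show ?thesis
    by (simp add: pot_U_def pot_V_def case_prod_beta Let_def)
qed

text \<open>\<open>sinkhorn_even \<dots> n\<close> is \<open>S\<^sub>2\<^sub>n\<close> and \<open>sinkhorn_odd \<dots> n\<close> is \<open>S\<^sub>2\<^sub>n\<^sub>+\<^sub>1\<close>;
  likewise for the laws \<open>\<pi>\<close>.\<close>

definition sinkhorn_even :: "'a measure \<Rightarrow> 'b measure \<Rightarrow> ('a \<Rightarrow> real) \<Rightarrow> ('b \<Rightarrow> real)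
    \<Rightarrow> ('a \<Rightarrow> 'b \<Rightarrow> real) \<Rightarrow> nat \<Rightarrow> 'a \<Rightarrow> 'b measure" where
  "sinkhorn_even lam nu U V W n x =
     density (kernel_Q nu W x) (\<lambda>y. ennreal (exp (- pot_V lam nu U V W (2*n) y)) /
       kapp (kernel_Q nu W) (\<lambda>z. exp (- pot_V lam nu U V W (2*n) z)) x)"

definition sinkhorn_odd :: "'a measure \<Rightarrow> 'b measure \<Rightarrow> ('a \<Rightarrow> real) \<Rightarrow> ('b \<Rightarrow> real)
    \<Rightarrow> ('a \<Rightarrow> 'b \<Rightarrow> real) \<Rightarrow> nat \<Rightarrow> 'b \<Rightarrow> 'a measure" where
  "sinkhorn_odd lam nu U V W n y =
     density (kernel_R lam W y) (\<lambda>x. ennreal (exp (- pot_U lam nu U V W (2*n+1) x)) /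
       kapp (kernel_R lam W) (\<lambda>z. exp (- pot_U lam nu U V W (2*n+1) z)) y)"

definition pi_even :: "'a measure \<Rightarrow> 'b measure \<Rightarrow> ('a \<Rightarrow> real) \<Rightarrow> ('b \<Rightarrow> real)
    \<Rightarrow> ('a \<Rightarrow> 'b \<Rightarrow> real) \<Rightarrow> nat \<Rightarrow> 'b measure" where
  "pi_even lam nu U V W n = Giry_Monad.bind (gibbs lam U) (sinkhorn_even lam nu U V W n)"

definition pi_odd :: "'a measure \<Rightarrow> 'b measure \<Rightarrow> ('a \<Rightarrow> real) \<Rightarrow> ('b \<Rightarrow> real)
    \<Rightarrow> ('a \<Rightarrow> 'b \<Rightarrow> real) \<Rightarrow> nat \<Rightarrow> 'a measure" where
  "pi_odd lam nu U V W n = Giry_Monad.bind (gibbs nu V) (sinkhorn_odd lam nu U V W n)"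

definition cost_U :: "'a measure \<Rightarrow> ('a \<Rightarrow> real) \<Rightarrow> ('a \<Rightarrow> 'b \<Rightarrow> real) \<Rightarrow> 'b \<Rightarrow> real" where
  "cost_U lam U W y = (\<integral>x. W x y \<partial>gibbs lam U)"

definition cost_V :: "'b measure \<Rightarrow> ('b \<Rightarrow> real) \<Rightarrow> ('a \<Rightarrow> 'b \<Rightarrow> real) \<Rightarrow> 'a \<Rightarrow> real" where
  "cost_V nu V W x = (\<integral>y. W x y \<partial>gibbs nu V)"

text \<open>The integrability clauses say that the integrated costs are finite, which is part of the local
  boundedness of \<open>\<delta>U - W\<^sup>V\<close> and \<open>\<delta>V - W\<^sub>U\<close>; without them the Bochner integrals would be 0.\<close>

definition cond_H :: "'a::topological_space measure \<Rightarrow> 'b::topological_space measure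
    \<Rightarrow> ('a \<Rightarrow> real) \<Rightarrow> ('b \<Rightarrow> real) \<Rightarrow> ('a \<Rightarrow> 'b \<Rightarrow> real) \<Rightarrow> real \<Rightarrow> bool" where
  "cond_H lam nu U V W \<delta> \<longleftrightarrow>
     (\<forall>x. integrable (gibbs nu V) (\<lambda>y. W x y)) \<and>
     (\<forall>y. integrable (gibbs lam U) (\<lambda>x. W x y)) \<and>
     locally_bounded (\<lambda>x. \<delta> * U x - cost_V nu V W x) \<and>
     compact_sublevels (\<lambda>x. \<delta> * U x - cost_V nu V W x) \<and>
     locally_bounded (\<lambda>y. \<delta> * V y - cost_U lam U W y) \<and>
     compact_sublevels (\<lambda>y. \<delta> * V y - cost_U lam U W y) \<and>
     max (\<integral>\<^sup>+ x. ennreal (exp (cost_V nu V W x)) \<partial>gibbs lam (\<lambda>x. (1 - \<delta>) * U x))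
         (\<integral>\<^sup>+ y. ennreal (exp (cost_U lam U W y)) \<partial>gibbs nu (\<lambda>y. (1 - \<delta>) * V y)) < \<infinity>"

text \<open>\<open>S n\<close> and \<open>T n\<close> stand for \<open>S\<^sub>2\<^sub>n\<close> and \<open>S\<^sub>2\<^sub>n\<^sub>+\<^sub>1\<close>. The points of \<open>N\<close> and \<open>N'\<close> are disregarded.
  The two variation bounds are stated separately: with joint quantification over
  \<open>x\<^sub>1, x\<^sub>2, y\<^sub>1, y\<^sub>2\<close> each would be void once the other sub-level set lies in its exceptional set.\<close>

definition cond_D :: "(nat \<Rightarrow> 'a \<Rightarrow> 'b measure) \<Rightarrow> (nat \<Rightarrow> 'b \<Rightarrow> 'a measure)
    \<Rightarrow> ('a \<Rightarrow> real) \<Rightarrow> ('b \<Rightarrow> real) \<Rightarrow> nat \<Rightarrow> 'a set \<Rightarrow> 'b set \<Rightarrow> bool" where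
  "cond_D S T \<phi> \<psi> n0 N N' \<longleftrightarrow>
     (\<forall>x. 1 \<le> \<phi> x) \<and> (\<forall>y. 1 \<le> \<psi> y) \<and>
     (\<exists>\<epsilon> c. 0 < \<epsilon> \<and> \<epsilon> < 1 \<and> 0 < c \<and>
        (\<forall>n\<ge>n0. (\<forall>x. x \<notin> N \<longrightarrow> kapp (S n) \<psi> x \<le> ennreal (\<epsilon> * \<phi> x + c)) \<and>
                (\<forall>y. y \<notin> N' \<longrightarrow> kapp (T n) \<phi> y \<le> ennreal (\<epsilon> * \<psi> y + c)))) \<and>
     (\<exists>r0 (e :: real \<Rightarrow> real). 1 \<le> r0 \<and> (\<forall>r\<ge>r0. 0 < e r \<and> e r \<le> 1) \<and>
        (\<forall>r\<ge>r0. \<forall>n\<ge>n0.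
           (\<forall>x1\<in>{x. \<phi> x \<le> r} - N. \<forall>x2\<in>{x. \<phi> x \<le> r} - N. tv_dist (S n x1) (S n x2) \<le> 1 - e r) \<and>
           (\<forall>y1\<in>{y. \<psi> y \<le> r} - N'. \<forall>y2\<in>{y. \<psi> y \<le> r} - N'. tv_dist (T n y1) (T n y2) \<le> 1 - e r)))"

end

theory Submission
  imports Defs
begin

text \<open>
  Write \<open>u\<^sub>n = U\<^sub>2\<^sub>n\<close>, \<open>v\<^sub>n = V\<^sub>2\<^sub>n\<close> and \<open>a = W\<^sup>V\<close>. Sinkhorn's recursion alternates the maps
  \<open>u\<^sub>n = U + ln Q(exp (- v\<^sub>n))\<close> and \<open>v\<^sub>n\<^sub>+\<^sub>1 = V + ln R(exp (- u\<^sub>n))\<close>, which are mirror images of each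
  other. So the whole argument is carried out for one half-step, in a locale that is symmetric under
  exchange of the two spaces, and is used twice. By Fubini the densities of \<open>\<pi>\<^sub>2\<^sub>n\<close> with respect to \<open>\<nu>\<^sub>V\<close>
  and of \<open>\<pi>\<^sub>2\<^sub>n\<^sub>+\<^sub>1\<close> with respect to \<open>\<lambda>\<^sub>U\<close> are
  \<open>exp (v\<^sub>n\<^sub>+\<^sub>1 - v\<^sub>n)\<close> and \<open>exp (u\<^sub>n\<^sub>+\<^sub>1 - u\<^sub>n)\<close>, so the second claim is about increments of potentials.

  \<^emph>\<open>Uniform bounds.\<close> As \<open>\<pi>\<^sub>2\<^sub>n\<close> has mass one, Jensen's inequality makes the mean of \<open>v\<^sub>n\<close> under \<open>\<nu>\<^sub>V\<close>
  nonincreasing in \<open>n\<close>, and likewise for \<open>u\<^sub>n\<close> (\<open>mean_decrease\<close>). Jensen again, now in the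
  recursion, turns an upper bound on the mean of one potential into the pointwise lower bound
  \<open>U - a - k \<le> u\<^sub>n\<close> on the other (\<open>update_lower\<close>). Inserted in the opposite recursion, this bound
  gives \<open>v\<^sub>n\<^sub>+\<^sub>1 \<le> V + l\<close>, because \<open>exp (- W)\<close> is bounded and \<open>exp (a - U)\<close> is integrable (\<open>partition_fun_le\<close>). No
  constant grows with \<open>n\<close>, since the lower bound on one side only sees the means on the other
  (\<open>potentials_tempered\<close>).

  \<^emph>\<open>Drift and overlap.\<close> These bounds control the densities of the kernels. From above they give
  \<open>S\<^sub>2\<^sub>n(\<psi>) \<le> L exp a\<close>, which is at most \<open>\<epsilon> \<phi> + c\<close> for every \<open>\<epsilon> > 0\<close> and a suitable \<open>c\<close>, because \<open>\<delta> U - a\<close> has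
  compact sub-level sets (\<open>kernel_drift\<close>). From below they give a positive multiple of
  \<open>exp (- V)\<close> on a fixed compact set, the same for all starting points in a sub-level set of \<open>\<phi>\<close> and all \<open>n \<ge> 1\<close>
  (\<open>kernel_minorised\<close>). This is the first claim.

  \<^emph>\<open>Contraction.\<close> For the increments \<open>h = v\<^sub>n\<^sub>+\<^sub>1 - v\<^sub>n\<close> and \<open>g = u\<^sub>n\<^sub>+\<^sub>1 - u\<^sub>n\<close>, Jensen gives
  \<open>- S\<^sub>2\<^sub>n(h) \<le> g \<le> - S\<^sub>2\<^sub>n\<^sub>+\<^sub>2(h)\<close> (\<open>update_gain\<close>). The minorising measure is the same for both kernels, so
  the argument of Hairer and Mattingly for Harris' theorem applies to this pair and shrinks the weighted
  oscillation by a fixed factor at every half-step (\<open>weighted_contraction\<close>, \<open>update_contracts\<close>).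
  Finally a function whose exponential is a probability density has no room for an additive
  constant, so that small oscillation forces \<open>h\<close> itself to be small (\<open>increment_normalised\<close>).
\<close>

section \<open>Jensen, weighted contraction and total variation\<close>

text \<open>Jensen's inequality in the form in which no integrability of \<open>exp \<circ> f\<close> has to be known
  beforehand: the tangent line to \<open>exp\<close> at the mean lies below \<open>exp\<close>.\<close>

lemma exp_integral_le_nn_integral_exp:
  fixes f :: "'a \<Rightarrow> real"
  assumes "prob_space P" and f: "integrable P f"
  shows "ennreal (exp (\<integral>x. f x \<partial>P)) \<le> (\<integral>\<^sup>+ x. ennreal (exp (f x)) \<partial>P)"
proof (cases "(\<integral>\<^sup>+ x. ennreal (exp (f x)) \<partial>P) = \<infinity>")
  case False
  interpret prob_space P by fact
  have [measurable]: "f \<in> borel_measurable P" using f by auto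
  let ?c = "\<integral>x. f x \<partial>P"
  have int: "integrable P (\<lambda>x. exp (f x))"
    using False by (intro integrableI_nonneg) (auto simp: top.not_eq_extremum)
  have "exp ?c = (\<integral>x. exp ?c * (1 + (f x - ?c)) \<partial>P)"
    using f by (simp add: prob_space)
  also have "\<dots> \<le> (\<integral>x. exp (f x) \<partial>P)"
  proof (rule integral_mono)
    show "integrable P (\<lambda>x. exp ?c * (1 + (f x - ?c)))" using f by auto
    fix x
    have "exp ?c * (1 + (f x - ?c)) \<le> exp ?c * exp (f x - ?c)"
      by (intro mult_left_mono exp_ge_add_one_self) auto
    also have "\<dots> = exp (f x)" by (simp flip: exp_add)
    finally show "exp ?c * (1 + (f x - ?c)) \<le> exp (f x)" .
  qed (fact int)
  finally show ?thesis
    by (subst nn_integral_eq_integral[OF int]) (auto intro: ennreal_leI)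
qed simp

text \<open>A weighted bound on oscillations is a weighted bound on the function up to an additive constant. The
  second form can be integrated against measures directly, and the first one is what a contraction
  estimate delivers; the proofs below go back and forth.\<close>

lemma shift_exists:
  fixes h w :: "'a \<Rightarrow> real"
  assumes osc: "\<And>x y. x \<in> A \<Longrightarrow> y \<in> A \<Longrightarrow> h x - h y \<le> w x + w y"
  shows "\<exists>s. \<forall>x\<in>A. \<bar>h x - s\<bar> \<le> w x"
proof (cases "A = {}")
  case False
  then obtain y0 where y0: "y0 \<in> A" by auto
  let ?s = "SUP x\<in>A. h x - w x"
  have up: "h x - w x \<le> h y + w y" if "x \<in> A" "y \<in> A" for x y
    using osc[OF that] by simp
  have bdd: "bdd_above ((\<lambda>x. h x - w x) ` A)"
    by (rule bdd_aboveI2[of _ _ "h y0 + w y0"]) (rule up[OF _ y0])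
  have "\<bar>h x - ?s\<bar> \<le> w x" if "x \<in> A" for x
  proof -
    have "h x - w x \<le> ?s" by (rule cSUP_upper[OF that bdd])
    moreover have "?s \<le> h x + w x" using False up that by (intro cSUP_least) auto
    ultimately show ?thesis by auto
  qed
  then show ?thesis by blast
qed simp

text \<open>The core of the proof of Harris' theorem by Hairer and Mattingly, for two probability densities that
  need not come from the same kernel. Away from the centre, where \<open>f1 + f2\<close> is large, the drift alone
  beats the constants. Near the centre the common part \<open>q\<close> cancels in the difference of the two integrals, and
  the mass \<open>\<alpha>\<close> that is gained pays for the additive constant of the drift. The weight of
  \<open>w\<close>, the threshold \<open>16 c\<close> and the factor \<open>3/4\<close> are chosen so that one rate serves both regimes:
  with \<open>\<beta> = \<alpha> / (2 c)\<close> the drift constant costs exactly \<open>\<beta> c = \<alpha> / 2\<close>.\<close>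

lemma weighted_contraction:
  fixes p1 p2 h w :: "'b \<Rightarrow> real"
  assumes p1: "integrable N p1" "\<And>y. 0 \<le> p1 y" "(\<integral>y. p1 y \<partial>N) = 1"
    and p2: "integrable N p2" "\<And>y. 0 \<le> p2 y" "(\<integral>y. p2 y \<partial>N) = 1"
    and w: "\<And>y. 0 \<le> w y" "w \<in> borel_measurable N"
    and drift1: "integrable N (\<lambda>y. w y * p1 y)" "(\<integral>y. w y * p1 y \<partial>N) \<le> f1 / 2 + c"
    and drift2: "integrable N (\<lambda>y. w y * p2 y)" "(\<integral>y. w y * p2 y \<partial>N) \<le> f2 / 2 + c"
    and minor: "f1 + f2 \<le> 16 * c \<Longrightarrow> \<exists>q. integrable N q \<and> (\<forall>y. 0 \<le> q y) \<and>
       (AE y in N. q y \<le> p1 y) \<and> (AE y in N. q y \<le> p2 y) \<and> \<alpha> \<le> (\<integral>y. q y \<partial>N)"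
    and f: "0 \<le> f1" "0 \<le> f2" and \<alpha>: "0 < \<alpha>" and c: "0 < c" and D: "0 \<le> D"
    and h: "h \<in> borel_measurable N" "AE y in N. \<bar>h y - s\<bar> \<le> D * (1 + \<alpha> / (2 * c) * w y)"
  shows "integrable N (\<lambda>y. h y * p1 y)"
    and "(\<integral>y. h y * p1 y \<partial>N) - (\<integral>y. h y * p2 y \<partial>N)
          \<le> max (3/4) (1 - \<alpha> / 2) * D * ((1 + \<alpha> / (2 * c) * f1) + (1 + \<alpha> / (2 * c) * f2))"
proof -
  define \<beta> where "\<beta> = \<alpha> / (2 * c)"
  define \<gamma> where "\<gamma> = max (3/4) (1 - \<alpha> / 2)"
  have \<beta>: "0 < \<beta>" using \<alpha> c by (simp add: \<beta>_def)
  have \<beta>c: "\<beta> * c = \<alpha> / 2" using c by (simp add: \<beta>_def)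
  note [measurable] = h(1) w(2) borel_measurable_integrable[OF p1(1)] borel_measurable_integrable[OF p2(1)]
  have hb: "AE y in N. \<bar>h y - s\<bar> \<le> D * (1 + \<beta> * w y)" using h(2) by (simp add: \<beta>_def)
  have int: "integrable N (\<lambda>y. (h y - s) * r y)" "integrable N (\<lambda>y. D * (1 + \<beta> * w y) * r y)"
    if r: "integrable N r" "AE y in N. 0 \<le> r y" "integrable N (\<lambda>y. w y * r y)" for r
  proof -
    have [measurable]: "r \<in> borel_measurable N" using r(1) by auto
    show *: "integrable N (\<lambda>y. D * (1 + \<beta> * w y) * r y)"
    proof -
      have "integrable N (\<lambda>y. D * r y + D * \<beta> * (w y * r y))" using r by auto
      then show ?thesis by (simp add: algebra_simps)
    qed
    show "integrable N (\<lambda>y. (h y - s) * r y)"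
    proof (rule Bochner_Integration.integrable_bound[OF *])
      show "AE y in N. norm ((h y - s) * r y) \<le> norm (D * (1 + \<beta> * w y) * r y)"
        using hb r(2)
      proof eventually_elim
        case (elim y)
        have "\<bar>(h y - s) * r y\<bar> = \<bar>h y - s\<bar> * r y" using elim(2) by (simp add: abs_mult)
        moreover have "\<bar>h y - s\<bar> * r y \<le> D * (1 + \<beta> * w y) * r y" using elim by (intro mult_right_mono)
        moreover have "0 \<le> D * (1 + \<beta> * w y) * r y" using D \<beta> w(1)[of y] elim by auto
        ultimately show ?case by simp
      qed
    qed auto
  qed
  have bound: "\<bar>\<integral>y. (h y - s) * r y \<partial>N\<bar> \<le> D * (\<integral>y. r y \<partial>N) + D * \<beta> * (\<integral>y. w y * r y \<partial>N)"
    if r: "integrable N r" "AE y in N. 0 \<le> r y" "integrable N (\<lambda>y. w y * r y)" for r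
  proof -
    note I = int[OF r]
    have "\<bar>\<integral>y. (h y - s) * r y \<partial>N\<bar> \<le> (\<integral>y. \<bar>(h y - s) * r y\<bar> \<partial>N)" by (rule integral_abs_bound)
    also have "\<dots> \<le> (\<integral>y. D * (1 + \<beta> * w y) * r y \<partial>N)"
    proof (rule integral_mono_AE)
      show "AE y in N. \<bar>(h y - s) * r y\<bar> \<le> D * (1 + \<beta> * w y) * r y"
        using hb r(2) by eventually_elim (auto simp: abs_mult intro!: mult_right_mono)
    qed (use I in auto)
    also have "\<dots> = (\<integral>y. D * r y + D * \<beta> * (w y * r y) \<partial>N)"
      by (intro Bochner_Integration.integral_cong) (auto simp: algebra_simps)
    also have "\<dots> = D * (\<integral>y. r y \<partial>N) + D * \<beta> * (\<integral>y. w y * r y \<partial>N)"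
      using r by simp
    finally show ?thesis .
  qed
  have nn1: "AE y in N. 0 \<le> p1 y" and nn2: "AE y in N. 0 \<le> p2 y" using p1(2) p2(2) by auto
  note I1 = int[OF p1(1) nn1 drift1(1)] and I2 = int[OF p2(1) nn2 drift2(1)]
  have J1: "integrable N (\<lambda>y. h y * p1 y)" and E1: "(\<integral>y. h y * p1 y \<partial>N) = (\<integral>y. (h y - s) * p1 y \<partial>N) + s"
  proof -
    have eq: "(\<lambda>y. h y * p1 y) = (\<lambda>y. (h y - s) * p1 y + s * p1 y)" by (auto simp: algebra_simps)
    show "integrable N (\<lambda>y. h y * p1 y)" unfolding eq using I1 p1 by auto
    show "(\<integral>y. h y * p1 y \<partial>N) = (\<integral>y. (h y - s) * p1 y \<partial>N) + s"
      unfolding eq using I1 p1 by simp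
  qed
  show "integrable N (\<lambda>y. h y * p1 y)" by (fact J1)
  have E2: "(\<integral>y. h y * p2 y \<partial>N) = (\<integral>y. (h y - s) * p2 y \<partial>N) + s"
  proof -
    have eq: "(\<lambda>y. h y * p2 y) = (\<lambda>y. (h y - s) * p2 y + s * p2 y)" by (auto simp: algebra_simps)
    show ?thesis unfolding eq using I2 p2 by simp
  qed
  let ?L = "(\<integral>y. h y * p1 y \<partial>N) - (\<integral>y. h y * p2 y \<partial>N)"
  \<comment> \<open>In both cases the shift \<open>s\<close> drops out, because the two densities have the same mass.\<close>
  have "?L \<le> D * (\<gamma> * ((1 + \<beta> * f1) + (1 + \<beta> * f2)))"
  proof (cases "f1 + f2 \<le> 16 * c")
    case True
    from minor[OF this] obtain q where q: "integrable N q" "\<And>y. 0 \<le> q y"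
       "AE y in N. q y \<le> p1 y" "AE y in N. q y \<le> p2 y" "\<alpha> \<le> (\<integral>y. q y \<partial>N)" by auto
    have [measurable]: "q \<in> borel_measurable N" using q(1) by auto
    have wq: "integrable N (\<lambda>y. w y * q y)"
    proof (rule Bochner_Integration.integrable_bound[OF drift1(1)])
      show "AE y in N. norm (w y * q y) \<le> norm (w y * p1 y)"
        using q(3) by eventually_elim (use w(1) q(2) p1(2) in \<open>auto simp: abs_mult intro!: mult_left_mono\<close>)
    qed auto
    have wq0: "0 \<le> (\<integral>y. w y * q y \<partial>N)" using w q by (intro integral_nonneg_AE) auto
    have part: "\<bar>\<integral>y. (h y - s) * (p y - q y) \<partial>N\<bar> \<le> D * (1 - \<alpha>) + D * \<beta> * (f / 2 + c)"
      "(\<integral>y. (h y - s) * (p y - q y) \<partial>N) = (\<integral>y. (h y - s) * p y \<partial>N) - (\<integral>y. (h y - s) * q y \<partial>N)"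
      if p: "integrable N p" "(\<integral>y. p y \<partial>N) = 1" "integrable N (\<lambda>y. w y * p y)"
        "(\<integral>y. w y * p y \<partial>N) \<le> f / 2 + c" "AE y in N. q y \<le> p y" for p f
    proof -
      have ge: "AE y in N. 0 \<le> p y - q y" using p(5) by eventually_elim auto
      have p_nn: "AE y in N. 0 \<le> p y" using p(5)
        by eventually_elim (use q(2) in \<open>blast intro: order_trans\<close>)
      have wpq: "integrable N (\<lambda>y. w y * (p y - q y))"
        using p wq by (simp add: right_diff_distrib)
      have "\<bar>\<integral>y. (h y - s) * (p y - q y) \<partial>N\<bar>
          \<le> D * (\<integral>y. p y - q y \<partial>N) + D * \<beta> * (\<integral>y. w y * (p y - q y) \<partial>N)"
        by (rule bound) (use p q ge wpq in auto)
      also have "(\<integral>y. p y - q y \<partial>N) = 1 - (\<integral>y. q y \<partial>N)" using p q by simp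
      also have "(\<integral>y. w y * (p y - q y) \<partial>N) = (\<integral>y. w y * p y \<partial>N) - (\<integral>y. w y * q y \<partial>N)"
        using p wq by (simp add: right_diff_distrib)
      also have "D * (1 - (\<integral>y. q y \<partial>N)) + D * \<beta> * ((\<integral>y. w y * p y \<partial>N) - (\<integral>y. w y * q y \<partial>N))
          \<le> D * (1 - \<alpha>) + D * \<beta> * (f / 2 + c)"
        using q(5) p(4) wq0 D \<beta> by (intro add_mono mult_left_mono) auto
      finally show "\<bar>\<integral>y. (h y - s) * (p y - q y) \<partial>N\<bar> \<le> D * (1 - \<alpha>) + D * \<beta> * (f / 2 + c)" .
      have "AE y in N. 0 \<le> q y" using q(2) by auto
      from int(1)[OF q(1) this wq] int(1)[OF p(1) p_nn p(3)]
      show "(\<integral>y. (h y - s) * (p y - q y) \<partial>N) = (\<integral>y. (h y - s) * p y \<partial>N) - (\<integral>y. (h y - s) * q y \<partial>N)"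
        by (simp add: right_diff_distrib)
    qed
    note P1 = part[OF p1(1,3) drift1 q(3)] and P2 = part[OF p2(1,3) drift2 q(4)]
    have "?L \<le> (D * (1 - \<alpha>) + D * \<beta> * (f1 / 2 + c)) + (D * (1 - \<alpha>) + D * \<beta> * (f2 / 2 + c))"
      using P1 P2 unfolding E1 E2 by linarith
    also have "\<dots> = D * (2 - 2 * \<alpha> + 2 * (\<beta> * c) + \<beta> * (f1 + f2) / 2)"
      by (simp add: algebra_simps)
    also have "\<dots> \<le> D * (\<gamma> * ((1 + \<beta> * f1) + (1 + \<beta> * f2)))"
    proof (intro mult_left_mono D)
      have g: "3/4 \<le> \<gamma>" "1 - \<alpha> / 2 \<le> \<gamma>" by (auto simp: \<gamma>_def)
      show "2 - 2 * \<alpha> + 2 * (\<beta> * c) + \<beta> * (f1 + f2) / 2 \<le> \<gamma> * ((1 + \<beta> * f1) + (1 + \<beta> * f2))"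
      proof -
        have eq: "(1 + \<beta> * f1) + (1 + \<beta> * f2) = 2 + \<beta> * (f1 + f2)" by (simp add: algebra_simps)
        have "0 \<le> \<beta> * (f1 + f2)" using \<beta> f by auto
        then have "3/4 * (\<beta> * (f1 + f2)) \<le> \<gamma> * (\<beta> * (f1 + f2))" using g by (intro mult_right_mono)
        then show ?thesis unfolding eq distrib_left[of \<gamma>] using g \<open>0 \<le> \<beta> * (f1 + f2)\<close> \<beta>c by linarith
      qed
    qed
    finally show ?thesis .
  next
    case False
    have "?L \<le> (D * 1 + D * \<beta> * (f1 / 2 + c)) + (D * 1 + D * \<beta> * (f2 / 2 + c))"
    proof -
      have "D * \<beta> * (\<integral>y. w y * p1 y \<partial>N) \<le> D * \<beta> * (f1 / 2 + c)"
        "D * \<beta> * (\<integral>y. w y * p2 y \<partial>N) \<le> D * \<beta> * (f2 / 2 + c)"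
        using D \<beta> drift1 drift2 by (auto intro!: mult_left_mono)
      then show ?thesis
        using bound[OF p1(1) nn1 drift1(1), unfolded p1(3)] bound[OF p2(1) nn2 drift2(1), unfolded p2(3)]
        unfolding E1 E2 by linarith
    qed
    also have "\<dots> = D * (2 + 2 * (\<beta> * c) + \<beta> * (f1 + f2) / 2)" by (simp add: algebra_simps)
    also have "\<dots> \<le> D * (\<gamma> * ((1 + \<beta> * f1) + (1 + \<beta> * f2)))"
    proof (intro mult_left_mono D)
      have g: "3/4 \<le> \<gamma>" "1 - \<alpha> / 2 \<le> \<gamma>" by (auto simp: \<gamma>_def)
      have "\<beta> * (16 * c) \<le> \<beta> * (f1 + f2)" using False \<beta> by (intro mult_left_mono) auto
      then have "8 * \<alpha> \<le> \<beta> * (f1 + f2)" using \<beta>c by simp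
      moreover have eq: "(1 + \<beta> * f1) + (1 + \<beta> * f2) = 2 + \<beta> * (f1 + f2)" by (simp add: algebra_simps)
      moreover have "3/4 * (\<beta> * (f1 + f2)) \<le> \<gamma> * (\<beta> * (f1 + f2))"
        using g \<beta> f by (intro mult_right_mono) auto
      ultimately show "2 + 2 * (\<beta> * c) + \<beta> * (f1 + f2) / 2 \<le> \<gamma> * ((1 + \<beta> * f1) + (1 + \<beta> * f2))"
        unfolding eq distrib_left[of \<gamma>] using g \<beta>c by linarith
    qed
    finally show ?thesis .
  qed
  then show "?L \<le> max (3/4) (1 - \<alpha> / 2) * D * ((1 + \<alpha> / (2 * c) * f1) + (1 + \<alpha> / (2 * c) * f2))"
    by (simp add: \<gamma>_def \<beta>_def algebra_simps)
qed

text \<open>On each cell of a partition the difference of the two measures is at most the sum of what they have in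
  excess of their common part, and these excesses have total mass at most \<open>1 - \<alpha>\<close> each.\<close>

lemma tv_dist_le_of_common_part:
  fixes p1 p2 q :: "'b \<Rightarrow> real"
  assumes p1: "integrable N p1" "\<And>y. 0 \<le> p1 y" "(\<integral>y. p1 y \<partial>N) = 1"
    and p2: "integrable N p2" "\<And>y. 0 \<le> p2 y" "(\<integral>y. p2 y \<partial>N) = 1"
    and q: "integrable N q" "AE y in N. q y \<le> p1 y" "AE y in N. q y \<le> p2 y" "\<alpha> \<le> (\<integral>y. q y \<partial>N)"
  shows "tv_dist (density N (\<lambda>y. ennreal (p1 y))) (density N (\<lambda>y. ennreal (p2 y))) \<le> 1 - \<alpha>"
proof -
  let ?P1 = "density N (\<lambda>y. ennreal (p1 y))" and ?P2 = "density N (\<lambda>y. ennreal (p2 y))"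
  let ?S = "{P. finite P \<and> P \<subseteq> sets ?P1 \<and> partition_on (space ?P1) P}"
  have ind: "measure (density N (\<lambda>y. ennreal (p y))) A = (\<integral>y. p y * indicator A y \<partial>N)"
    if "integrable N p" "\<And>y. 0 \<le> p y" "A \<in> sets N" for p A
  proof -
    have int: "integrable N (\<lambda>y. p y * indicator A y)" using that by (intro integrable_real_mult_indicator)
    have "emeasure (density N (\<lambda>y. ennreal (p y))) A = (\<integral>\<^sup>+ y. ennreal (p y * indicator A y) \<partial>N)"
      using that by (subst emeasure_density) (auto simp: ennreal_mult'' ennreal_indicator)
    also have "\<dots> = ennreal (\<integral>y. p y * indicator A y \<partial>N)"
      using that int by (intro nn_integral_eq_integral) auto
    finally show ?thesis
      using that by (simp add: Sigma_Algebra.measure_def integral_nonneg_AE)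
  qed
  have sum_le: "(\<Sum>A\<in>P. \<bar>measure ?P1 A - measure ?P2 A\<bar>) \<le> 2 * (1 - \<alpha>)" if P: "P \<in> ?S" for P
  proof -
    from P have fin: "finite P" and sub: "\<And>A. A \<in> P \<Longrightarrow> A \<in> sets N"
      and disj: "disjoint P" and un: "\<Union>P = space N"
      by (auto simp: partition_on_def)
    have split: "(\<Sum>A\<in>P. \<integral>y. r y * indicator A y \<partial>N) = (\<integral>y. r y \<partial>N)" if r: "integrable N r" for r :: "'b \<Rightarrow> real"
    proof -
      have "(\<Sum>A\<in>P. \<integral>y. r y * indicator A y \<partial>N) = (\<integral>y. (\<Sum>A\<in>P. r y * indicator A y) \<partial>N)"
        using r sub by (intro Bochner_Integration.integral_sum[symmetric] integrable_real_mult_indicator)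
      also have "\<dots> = (\<integral>y. r y \<partial>N)"
      proof (rule Bochner_Integration.integral_cong[OF refl])
        fix y assume "y \<in> space N"
        then obtain A0 where A0: "A0 \<in> P" "y \<in> A0" using un by auto
        have "indicator A y = (if A = A0 then 1 else 0 :: real)" if "A \<in> P" for A
          using that A0 disj by (auto simp: disjoint_def indicator_def)
        then have "(\<Sum>A\<in>P. r y * indicator A y) = (\<Sum>A\<in>P. if A = A0 then r y else 0)"
          by (intro sum.cong) auto
        then show "(\<Sum>A\<in>P. r y * indicator A y) = r y" using fin A0 by simp
      qed
      finally show ?thesis .
    qed
    have "(\<Sum>A\<in>P. \<bar>measure ?P1 A - measure ?P2 A\<bar>)
        \<le> (\<Sum>A\<in>P. (\<integral>y. (p1 y - q y) * indicator A y \<partial>N) + (\<integral>y. (p2 y - q y) * indicator A y \<partial>N))"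
    proof (rule sum_mono)
      fix A assume A: "A \<in> P"
      have i: "integrable N (\<lambda>y. p1 y * indicator A y)" "integrable N (\<lambda>y. p2 y * indicator A y)"
        "integrable N (\<lambda>y. q y * indicator A y)"
        using p1 p2 q sub[OF A] by (auto intro!: integrable_real_mult_indicator)
      have "0 \<le> (\<integral>y. (p1 y - q y) * indicator A y \<partial>N)"
        by (rule integral_nonneg_AE) (use q(2) in \<open>eventually_elim, auto simp: indicator_def\<close>)
      moreover have "0 \<le> (\<integral>y. (p2 y - q y) * indicator A y \<partial>N)"
        by (rule integral_nonneg_AE) (use q(3) in \<open>eventually_elim, auto simp: indicator_def\<close>)
      ultimately show "\<bar>measure ?P1 A - measure ?P2 A\<bar>
          \<le> (\<integral>y. (p1 y - q y) * indicator A y \<partial>N) + (\<integral>y. (p2 y - q y) * indicator A y \<partial>N)"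
        unfolding ind[OF p1(1,2) sub[OF A]] ind[OF p2(1,2) sub[OF A]]
        using i by (simp add: left_diff_distrib)
    qed
    also have "\<dots> = (\<integral>y. p1 y - q y \<partial>N) + (\<integral>y. p2 y - q y \<partial>N)"
      using p1 p2 q by (subst sum.distrib, subst (1 2) split) auto
    also have "\<dots> \<le> 2 * (1 - \<alpha>)" using p1 p2 q by simp
    finally show ?thesis .
  qed
  have ne: "?S \<noteq> {}"
  proof (cases "space N = {}")
    case True
    then have "{} \<in> ?S" by (auto simp: partition_on_def disjoint_def)
    then show ?thesis by blast
  next
    case False
    then have "{space N} \<in> ?S" by (auto simp: partition_on_def disjoint_def)
    then show ?thesis by blast
  qed
  have "(SUP P \<in> ?S. \<Sum>A\<in>P. \<bar>measure ?P1 A - measure ?P2 A\<bar>) \<le> 2 * (1 - \<alpha>)"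
    by (intro cSUP_least ne sum_le)
  then show ?thesis unfolding tv_dist_def by simp
qed

section \<open>Gibbs kernels and tempered potentials\<close>

text \<open>For \<open>W\<close> with its arguments exchanged, \<open>kernel_Q\<close> becomes \<open>kernel_R\<close> and \<open>cost_V\<close> becomes \<open>cost_U\<close>.
  So the notions below, phrased for the direction in which a potential on the second space is
  transported to the first, cover both half-steps.\<close>

abbreviation partition_fun :: "'b measure \<Rightarrow> ('a \<Rightarrow> 'b \<Rightarrow> real) \<Rightarrow> ('b \<Rightarrow> real) \<Rightarrow> 'a \<Rightarrow> ennreal" where
  "partition_fun N W v x \<equiv> kapp (kernel_Q N W) (\<lambda>y. exp (- v y)) x"

definition sinkhorn_update ::
  "'b measure \<Rightarrow> ('a \<Rightarrow> real) \<Rightarrow> ('a \<Rightarrow> 'b \<Rightarrow> real) \<Rightarrow> ('b \<Rightarrow> real) \<Rightarrow> 'a \<Rightarrow> real" where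
  "sinkhorn_update N U W v x = U x + ln (enn2real (partition_fun N W v x))"

definition gibbs_kernel ::
  "'b measure \<Rightarrow> ('a \<Rightarrow> 'b \<Rightarrow> real) \<Rightarrow> ('b \<Rightarrow> real) \<Rightarrow> 'a \<Rightarrow> 'b measure" where
  "gibbs_kernel N W v x =
     density (kernel_Q N W x) (\<lambda>y. ennreal (exp (- v y)) / partition_fun N W v x)"

definition gibbs_density ::
  "'b measure \<Rightarrow> ('a \<Rightarrow> 'b \<Rightarrow> real) \<Rightarrow> ('b \<Rightarrow> real) \<Rightarrow> 'a \<Rightarrow> 'b \<Rightarrow> real" where
  "gibbs_density N W v x y = exp (- W x y - v y) / enn2real (partition_fun N W v x)"

text \<open>The two-sided bound satisfied by all iterates but the initial potential on the second space. Nothing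
  is claimed on \<open>E\<close>, which is to contain the points whose cost is not essentially bounded below.\<close>

definition tempered ::
  "'a measure \<Rightarrow> ('a \<Rightarrow> real) \<Rightarrow> ('a \<Rightarrow> real) \<Rightarrow> 'a set \<Rightarrow> real \<Rightarrow> real \<Rightarrow> ('a \<Rightarrow> real) \<Rightarrow> bool" where
  "tempered M U a E k l u \<longleftrightarrow> u \<in> borel_measurable M \<and>
     (\<forall>x. x \<notin> E \<longrightarrow> U x - a x - k \<le> u x \<and> u x \<le> U x + l)"

text \<open>A potential and its update are both tempered: the update bounds the normalising constant of the
  Gibbs kernel, so this is what pointwise bounds on the density of that kernel require.\<close>

definition admissible ::
  "'a measure \<Rightarrow> 'b measure \<Rightarrow> ('a \<Rightarrow> real) \<Rightarrow> ('b \<Rightarrow> real) \<Rightarrow> ('a \<Rightarrow> 'b \<Rightarrow> real) \<Rightarrow> 'a set \<Rightarrow> 'b set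
    \<Rightarrow> real \<Rightarrow> real \<Rightarrow> ('b \<Rightarrow> real) \<Rightarrow> bool" where
  "admissible M N U V W NX NY k l v \<longleftrightarrow>
     tempered N V (cost_V M U (\<lambda>y x. W x y)) NY k l v \<and>
     tempered M U (cost_V N V W) NX k l (sinkhorn_update N U W v)"

text \<open>The reference measure has a positive finite density with respect to its Gibbs probability.\<close>

lemma sigma_finite_of_gibbs:
  assumes [measurable]: "F \<in> borel_measurable M" and "prob_space (gibbs M F)"
  shows "sigma_finite_measure M"
proof -
  interpret G: prob_space "gibbs M F" by fact
  have "density (gibbs M F) (\<lambda>x. ennreal (exp (F x))) = density M (\<lambda>x. 1)"
    unfolding gibbs_def by (subst density_density_eq) (auto simp: mult_exp_exp simp flip: ennreal_mult')
  then have "M = density (gibbs M F) (\<lambda>x. ennreal (exp (F x)))" by (simp add: density_1)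
  moreover have "sigma_finite_measure (density (gibbs M F) (\<lambda>x. ennreal (exp (F x))))"
    by (subst G.sigma_finite_iff_density_finite) (auto simp: gibbs_def)
  ultimately show ?thesis by metis
qed

lemma nn_integral_gibbs:
  assumes [measurable]: "F \<in> borel_measurable M" "f \<in> borel_measurable M"
  shows "(\<integral>\<^sup>+ x. f x \<partial>gibbs M F) = (\<integral>\<^sup>+ x. ennreal (exp (- F x)) * f x \<partial>M)"
  unfolding gibbs_def by (rule nn_integral_density) auto

lemma AE_gibbs:
  assumes [measurable]: "F \<in> borel_measurable M" 
  shows "(AE x in gibbs M F. P x) \<longleftrightarrow> (AE x in M. P x)"
  unfolding gibbs_def by (subst AE_density) auto

lemma sets_gibbs [simp, measurable_cong]: "sets (gibbs M F) = sets M"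
  and space_gibbs [simp]: "space (gibbs M F) = space M"
  by (auto simp: gibbs_def)

section \<open>A priori bounds for one update of a potential\<close>

text \<open>What the argument uses of the regularity assumptions and of condition \<open>H\<^sub>\<delta>\<close>, free of topology and
  symmetric in the two spaces. \<open>cost_growth_X\<close> replaces the compact sub-level sets of
  \<open>\<delta> U - W\<^sup>V\<close>; the sets \<open>B\<close> in \<open>small_X\<close> and \<open>small_Y\<close> replace compact sets that carry the common part
  of the kernels; \<open>NX\<close> and \<open>NY\<close> carry the failure of a pointwise lower bound on \<open>W\<close>.\<close>

locale cost_pair =
  fixes M :: "'a measure" and N :: "'b measure"
    and U :: "'a \<Rightarrow> real" and V :: "'b \<Rightarrow> real" and W :: "'a \<Rightarrow> 'b \<Rightarrow> real"
    and C \<delta> :: real and NX :: "'a set" and NY :: "'b set"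
  assumes space_M: "space M = UNIV" and space_N: "space N = UNIV"
    and U_meas: "U \<in> borel_measurable M" and V_meas: "V \<in> borel_measurable N"
    and W_meas: "case_prod W \<in> borel_measurable (M \<Otimes>\<^sub>M N)"
    and prob_U: "prob_space (gibbs M U)" and prob_V: "prob_space (gibbs N V)"
    and W_int_V: "\<And>x. integrable (gibbs N V) (\<lambda>y. W x y)"
    and W_int_U: "\<And>y. integrable (gibbs M U) (\<lambda>x. W x y)"
    and C_pos: "0 < C" and \<delta>_pos: "0 < \<delta>"
    and null_X: "NX \<in> null_sets M" and null_Y: "NY \<in> null_sets N"
    and W_bound_X: "\<And>x. x \<notin> NX \<Longrightarrow> AE y in N. exp (- W x y) \<le> C"
    and W_bound_Y: "\<And>y. y \<notin> NY \<Longrightarrow> AE x in M. exp (- W x y) \<le> C"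
    and U_bdd: "bdd_below (range U)" and V_bdd: "bdd_below (range V)"
    and cost_growth_X: "\<And>\<epsilon>. 0 < \<epsilon> \<Longrightarrow>
      \<exists>c. \<forall>x. exp (cost_V N V W x) \<le> \<epsilon> * exp (\<delta> * U x) + c"
    and cost_growth_Y: "\<And>\<epsilon>. 0 < \<epsilon> \<Longrightarrow>
      \<exists>c. \<forall>y. exp (cost_V M U (\<lambda>y x. W x y) y) \<le> \<epsilon> * exp (\<delta> * V y) + c"
    and exp_cost_X: "(\<integral>\<^sup>+ x. ennreal (exp (cost_V N V W x)) \<partial>gibbs M (\<lambda>x. (1 - \<delta>) * U x)) < \<infinity>"
    and exp_cost_Y: "(\<integral>\<^sup>+ y. ennreal (exp (cost_V M U (\<lambda>y x. W x y) y))
      \<partial>gibbs N (\<lambda>y. (1 - \<delta>) * V y)) < \<infinity>"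
    and small_Y: "\<exists>B\<in>sets N. 0 < measure (gibbs N V) B \<and>
      (\<forall>r. \<exists>w. \<forall>x y. U x \<le> r \<longrightarrow> y \<in> B \<longrightarrow> W x y \<le> w)"
    and small_X: "\<exists>B\<in>sets M. 0 < measure (gibbs M U) B \<and>
      (\<forall>r. \<exists>w. \<forall>y x. V y \<le> r \<longrightarrow> x \<in> B \<longrightarrow> W x y \<le> w)"
begin

lemma swap: "cost_pair N M V U (\<lambda>y x. W x y) C \<delta> NY NX"
proof (rule cost_pair.intro)
  show "(\<lambda>(y, x). W x y) \<in> borel_measurable (N \<Otimes>\<^sub>M M)"
    using measurable_compose[OF measurable_pair_swap'[of N M] W_meas] by (simp add: case_prod_beta')
qed (rule space_M space_N U_meas V_meas prob_U prob_V W_int_V W_int_U C_pos \<delta>_pos null_X null_Y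
  W_bound_X W_bound_Y U_bdd V_bdd cost_growth_X cost_growth_Y exp_cost_X exp_cost_Y small_X small_Y
  | assumption)+

lemma sigma_finite_M: "sigma_finite_measure M"
  and sigma_finite_N: "sigma_finite_measure N"
  using sigma_finite_of_gibbs U_meas V_meas prob_U prob_V by blast+

lemma W_section [measurable]: "W x \<in> borel_measurable N"
  using measurable_compose[OF measurable_Pair1'[of x M N] W_meas] by (simp add: space_M)

lemma cost_measurable [measurable]: "cost_V N V W \<in> borel_measurable M"
proof -
  interpret prob_space "gibbs N V" by (rule prob_V)
  have "case_prod W \<in> borel_measurable (M \<Otimes>\<^sub>M gibbs N V)"
    using W_meas by (simp add: measurable_cong_sets[OF sets_pair_measure_cong[OF refl sets_gibbs] refl])
  then show ?thesis unfolding cost_V_def[abs_def] by (rule borel_measurable_lebesgue_integral)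
qed

lemma partition_fun_eq:
  assumes [measurable]: "v \<in> borel_measurable N"
  shows "partition_fun N W v x = (\<integral>\<^sup>+ y. ennreal (exp (- W x y - v y)) \<partial>N)"
proof -
  have "partition_fun N W v x = (\<integral>\<^sup>+ y. ennreal (exp (- W x y)) * ennreal (exp (- v y)) \<partial>N)"
    unfolding kapp_def kernel_Q_def by (rule nn_integral_density) auto
  then show ?thesis by (simp add: exp_diff exp_minus divide_inverse flip: ennreal_mult')
qed

lemma partition_fun_pos:
  assumes [measurable]: "v \<in> borel_measurable N"
  shows "0 < partition_fun N W v x"
proof (rule ccontr)
  assume "\<not> 0 < partition_fun N W v x"
  then have "(\<integral>\<^sup>+ y. ennreal (exp (- W x y - v y)) \<partial>N) = 0"
    by (simp add: partition_fun_eq zero_less_iff_neq_zero)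
  then have "AE y in N. False" by (subst (asm) nn_integral_0_iff_AE) auto
  then have "AE y in gibbs N V. False" using V_meas by (simp add: AE_gibbs)
  then show False using prob_space.AE_False[OF prob_V] by simp
qed

lemma partition_fun_measurable [measurable]:
  assumes [measurable]: "v \<in> borel_measurable N"
  shows "(\<lambda>x. partition_fun N W v x) \<in> borel_measurable M"
proof -
  interpret sigma_finite_measure N by (rule sigma_finite_N)
  note [measurable] = W_meas
  have "(\<lambda>z. W (fst z) (snd z)) \<in> borel_measurable (M \<Otimes>\<^sub>M N)" using W_meas by (simp add: case_prod_beta')
  note [measurable] = this
  have "(\<lambda>x. \<integral>\<^sup>+ y. ennreal (exp (- W x y - v y)) \<partial>N) \<in> borel_measurable M"
    by (rule borel_measurable_nn_integral) (simp add: case_prod_beta')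
  then show ?thesis by (simp add: partition_fun_eq)
qed

lemma sinkhorn_update_measurable [measurable]:
  "v \<in> borel_measurable N \<Longrightarrow> U' \<in> borel_measurable M \<Longrightarrow> sinkhorn_update N U' W v \<in> borel_measurable M"
  unfolding sinkhorn_update_def[abs_def]
  by (intro borel_measurable_add borel_measurable_ln borel_measurable_enn2real partition_fun_measurable)

text \<open>The update inverts the definition of the normalising constant: \<open>Z = exp (u - U)\<close>. Bounds
  on the updated potential and bounds on \<open>Z\<close> are therefore interchangeable.\<close>

lemma partition_fun_update:
  assumes "v \<in> borel_measurable N" "partition_fun N W v x < \<infinity>"
  shows "enn2real (partition_fun N W v x) = exp (sinkhorn_update N U' W v x - U' x)"
    and "partition_fun N W v x = ennreal (exp (sinkhorn_update N U' W v x - U' x))"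
    and "0 < enn2real (partition_fun N W v x)"
proof -
  show pos: "0 < enn2real (partition_fun N W v x)"
    using partition_fun_pos[OF assms(1)] assms(2) by (simp add: enn2real_positive_iff)
  then show eq: "enn2real (partition_fun N W v x) = exp (sinkhorn_update N U' W v x - U' x)"
    unfolding sinkhorn_update_def add_diff_cancel_left' by (rule exp_ln[symmetric])
  have "ennreal (enn2real (partition_fun N W v x)) = partition_fun N W v x"
    using assms(2) unfolding infinity_ennreal_def by (rule ennreal_enn2real)
  then show "partition_fun N W v x = ennreal (exp (sinkhorn_update N U' W v x - U' x))"
    unfolding eq by (rule sym)
qed

lemma cost_lower: "- ln C \<le> cost_V N V W x" if "x \<notin> NX"
proof -
  interpret prob_space "gibbs N V" by (rule prob_V)
  have "AE y in gibbs N V. - ln C \<le> W x y"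
    unfolding AE_gibbs[OF V_meas] using W_bound_X[OF that]
  proof eventually_elim
    case (elim y)
    then have "- W x y \<le> ln C" using C_pos by (subst ln_ge_iff) auto
    then show ?case by simp
  qed
  then show ?thesis unfolding cost_V_def by (intro integral_ge_const W_int_V)
qed

lemma exp_cost_finite: "(\<integral>\<^sup>+ x. ennreal (exp (cost_V N V W x - (1 - \<delta>) * U x)) \<partial>M) < \<infinity>"
proof -
  note [measurable] = U_meas
  have "(\<integral>\<^sup>+ x. ennreal (exp (cost_V N V W x)) \<partial>gibbs M (\<lambda>x. (1 - \<delta>) * U x))
      = (\<integral>\<^sup>+ x. ennreal (exp (cost_V N V W x - (1 - \<delta>) * U x)) \<partial>M)"
    by (subst nn_integral_gibbs)
      (auto simp flip: ennreal_mult' exp_add intro!: nn_integral_cong arg_cong[where f=ennreal] arg_cong[where f=exp])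
  then show ?thesis using exp_cost_X by simp
qed

text \<open>The integrated cost is bounded below outside the exceptional set, so the assumption on
  \<open>exp (W\<^sup>V)\<close> gives an exponential moment of \<open>U\<close> itself.\<close>

lemma integrable_exp_U: "integrable (gibbs M U) (\<lambda>x. exp (\<delta> * U x))"
proof (rule integrableI_nonneg)
  note [measurable] = U_meas
  show "(\<lambda>x. exp (\<delta> * U x)) \<in> borel_measurable (gibbs M U)" by measurable
  have "(\<integral>\<^sup>+ x. ennreal (exp (\<delta> * U x)) \<partial>gibbs M U) = (\<integral>\<^sup>+ x. ennreal (exp (- U x)) * ennreal (exp (\<delta> * U x)) \<partial>M)"
    by (rule nn_integral_gibbs) auto
  also have "\<dots> \<le> (\<integral>\<^sup>+ x. ennreal C * ennreal (exp (cost_V N V W x - (1 - \<delta>) * U x)) \<partial>M)"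
  proof (rule nn_integral_mono_AE)
    show "AE x in M. ennreal (exp (- U x)) * ennreal (exp (\<delta> * U x))
        \<le> ennreal C * ennreal (exp (cost_V N V W x - (1 - \<delta>) * U x))"
      using AE_not_in[OF null_X]
    proof eventually_elim
      case (elim x)
      have "exp (- U x) * exp (\<delta> * U x) \<le> exp (ln C) * exp (cost_V N V W x - (1 - \<delta>) * U x)"
        using cost_lower[OF elim] by (simp flip: exp_add) (simp add: algebra_simps)
      then show ?case using C_pos by (simp flip: ennreal_mult')
    qed
  qed
  also have "\<dots> = ennreal C * (\<integral>\<^sup>+ x. ennreal (exp (cost_V N V W x - (1 - \<delta>) * U x)) \<partial>M)"
    by (rule nn_integral_cmult) auto
  also have "\<dots> < \<infinity>" using exp_cost_finite by (simp add: ennreal_mult_less_top)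
  finally show "(\<integral>\<^sup>+ x. ennreal (exp (\<delta> * U x)) \<partial>gibbs M U) < \<infinity>" .
qed auto

lemma integrable_U: "integrable (gibbs M U) U"
proof -
  note [measurable] = U_meas
  interpret prob_space "gibbs M U" by (rule prob_U)
  obtain m where m: "\<And>x. m \<le> U x" using U_bdd by (auto simp: bdd_below_def)
  have "integrable (gibbs M U) (\<lambda>x. U x - m)"
  proof (rule Bochner_Integration.integrable_bound)
    show "integrable (gibbs M U) (\<lambda>x. exp (- \<delta> * m) / \<delta> * exp (\<delta> * U x))"
      using integrable_exp_U by auto
    show "AE x in gibbs M U. norm (U x - m) \<le> norm (exp (- \<delta> * m) / \<delta> * exp (\<delta> * U x))"
    proof (rule AE_I2)
      fix x
      have "\<delta> * (U x - m) \<le> exp (\<delta> * (U x - m))"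
        using exp_ge_add_one_self[of "\<delta> * (U x - m)"] by linarith
      then have "U x - m \<le> exp (\<delta> * (U x - m)) / \<delta>"
        using \<delta>_pos by (simp add: field_simps)
      then show "norm (U x - m) \<le> norm (exp (- \<delta> * m) / \<delta> * exp (\<delta> * U x))"
        using \<delta>_pos m[of x] by (simp add: right_diff_distrib exp_diff exp_minus field_simps)
    qed
  qed auto
  then have "integrable (gibbs M U) (\<lambda>x. (U x - m) + m)" by (intro Bochner_Integration.integrable_add) auto
  then show ?thesis by simp
qed

text \<open>Since \<open>U\<close> is bounded below, the additive constant in \<open>cost_growth_X\<close> is absorbed by a multiple of
  \<open>exp (\<delta> U)\<close>.\<close>

lemma cost_upper: "\<exists>c. \<forall>x. cost_V N V W x \<le> \<delta> * U x + c"
proof -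
  obtain m where m: "\<And>x. m \<le> U x" using U_bdd by (auto simp: bdd_below_def)
  obtain c where c: "\<And>x. exp (cost_V N V W x) \<le> 1 * exp (\<delta> * U x) + c"
    using cost_growth_X[of 1] by auto
  have "cost_V N V W x \<le> \<delta> * U x + ln (1 + \<bar>c\<bar> * exp (- \<delta> * m))" for x
  proof -
    have "c \<le> \<bar>c\<bar> * exp (\<delta> * (U x - m))"
    proof -
      have "1 \<le> exp (\<delta> * (U x - m))" using m[of x] \<delta>_pos by simp
      then have "\<bar>c\<bar> * 1 \<le> \<bar>c\<bar> * exp (\<delta> * (U x - m))" by (intro mult_left_mono) auto
      then show ?thesis by simp
    qed
    then have "exp (cost_V N V W x) \<le> exp (\<delta> * U x) * (1 + \<bar>c\<bar> * exp (- \<delta> * m))"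
      using c[of x] by (simp add: algebra_simps exp_diff exp_minus divide_inverse)
    also have "\<dots> = exp (\<delta> * U x + ln (1 + \<bar>c\<bar> * exp (- \<delta> * m)))"
      by (simp add: exp_add add_pos_nonneg)
    finally show ?thesis by simp
  qed
  then show ?thesis by blast
qed

lemma integrable_tempered:
  assumes "tempered M U (cost_V N V W) NX k l u"
  shows "integrable (gibbs M U) u"
proof -
  have [measurable]: "u \<in> borel_measurable M" using assms by (simp add: tempered_def)
  note [measurable] = U_meas
  interpret prob_space "gibbs M U" by (rule prob_U)
  obtain c where c: "\<And>x. cost_V N V W x \<le> \<delta> * U x + c" using cost_upper by auto
  show ?thesis
  proof (rule Bochner_Integration.integrable_bound)
    show "integrable (gibbs M U) (\<lambda>x. (2 + \<delta>) * \<bar>U x\<bar> + (\<bar>c\<bar> + \<bar>k\<bar> + \<bar>l\<bar>))"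
      using integrable_U by auto
    show "AE x in gibbs M U. norm (u x) \<le> norm ((2 + \<delta>) * \<bar>U x\<bar> + (\<bar>c\<bar> + \<bar>k\<bar> + \<bar>l\<bar>))"
      unfolding AE_gibbs[OF U_meas] using AE_not_in[OF null_X]
    proof eventually_elim
      case (elim x)
      have "\<bar>\<delta> * U x\<bar> = \<delta> * \<bar>U x\<bar>" using \<delta>_pos by (simp add: abs_mult)
      moreover have "U x - cost_V N V W x - k \<le> u x" "u x \<le> U x + l" using assms elim by (auto simp: tempered_def)
      ultimately have "\<bar>u x\<bar> \<le> (2 + \<delta>) * \<bar>U x\<bar> + (\<bar>c\<bar> + \<bar>k\<bar> + \<bar>l\<bar>)"
        using c[of x] unfolding distrib_right by linarith
      then show ?case by simp
    qed
  qed auto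
qed

text \<open>The upper half of the a priori bound: with \<open>exp (- W) \<le> C\<close> and the lower bound on \<open>v\<close>, the
  normalising constant is at most a multiple of the integral of \<open>exp (W\<^sub>U - V)\<close>, which is finite by the
  exponential moment of the cost. The constant \<open>L\<close> does not depend on the potential.\<close>

lemma partition_fun_le:
  "\<exists>L. \<forall>k v x. v \<in> borel_measurable N \<longrightarrow>
     (AE y in N. V y - cost_V M U (\<lambda>y x. W x y) y - k \<le> v y) \<longrightarrow> x \<notin> NX \<longrightarrow>
     partition_fun N W v x \<le> ennreal (exp (L + k))"
proof -
  interpret sw: cost_pair N M V U "\<lambda>y x. W x y" C \<delta> NY NX by (rule swap)
  note [measurable] = V_meas
  let ?b = "cost_V M U (\<lambda>y x. W x y)"
  obtain m where m: "\<And>y. m \<le> V y" using V_bdd by (auto simp: bdd_below_def)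
  define I where "I = enn2real (\<integral>\<^sup>+ y. ennreal (exp (?b y - (1 - \<delta>) * V y)) \<partial>N)"
  have I: "(\<integral>\<^sup>+ y. ennreal (exp (?b y - (1 - \<delta>) * V y)) \<partial>N) = ennreal I" "0 \<le> I"
    using sw.exp_cost_finite by (auto simp: I_def)
  have "partition_fun N W v x \<le> ennreal (exp (ln (C * exp (- \<delta> * m) * (I + 1)) + k))"
    if v[measurable]: "v \<in> borel_measurable N" and lower: "AE y in N. V y - ?b y - k \<le> v y" and x: "x \<notin> NX" for k v x
  proof -
    have "partition_fun N W v x = (\<integral>\<^sup>+ y. ennreal (exp (- W x y - v y)) \<partial>N)" by (simp add: partition_fun_eq)
    also have "\<dots> \<le> (\<integral>\<^sup>+ y. ennreal (C * exp (- \<delta> * m) * exp k) * ennreal (exp (?b y - (1 - \<delta>) * V y)) \<partial>N)"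
    proof (rule nn_integral_mono_AE)
      show "AE y in N. ennreal (exp (- W x y - v y)) \<le> ennreal (C * exp (- \<delta> * m) * exp k) * ennreal (exp (?b y - (1 - \<delta>) * V y))"
        using W_bound_X[OF x] lower
      proof eventually_elim
        case (elim y)
        have "exp (- W x y - v y) = exp (- W x y) * exp (- v y)" by (simp flip: exp_add)
        also have "\<dots> \<le> C * exp (- \<delta> * m + k + (?b y - (1 - \<delta>) * V y))"
        proof (rule mult_mono)
          have "\<delta> * m \<le> \<delta> * V y" using m \<delta>_pos by simp
          then show "exp (- v y) \<le> exp (- \<delta> * m + k + (?b y - (1 - \<delta>) * V y))"
            using elim by (simp add: algebra_simps)
        qed (use elim C_pos in auto)
        also have "\<dots> = C * exp (- \<delta> * m) * exp k * exp (?b y - (1 - \<delta>) * V y)" by (simp only: exp_add mult.assoc)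
        finally show ?case using C_pos by (subst ennreal_mult'[symmetric]) (auto intro: ennreal_leI)
      qed
    qed
    also have "\<dots> = ennreal (C * exp (- \<delta> * m) * exp k) * ennreal I"
      by (subst nn_integral_cmult) (auto simp: I)
    also have "\<dots> \<le> ennreal (C * exp (- \<delta> * m) * (I + 1) * exp k)"
      using I C_pos by (subst ennreal_mult'[symmetric]) (auto intro!: ennreal_leI mult_left_mono simp: algebra_simps)
    also have "C * exp (- \<delta> * m) * (I + 1) * exp k = exp (ln (C * exp (- \<delta> * m) * (I + 1)) + k)"
      using I C_pos by (subst exp_add, subst exp_ln) (auto intro!: mult_pos_pos)
    finally show ?thesis .
  qed
  from this show ?thesis by (intro exI allI impI)
qed

text \<open>The lower half of the a priori bound. Writing the normalising constant as an integral of
  \<open>exp (V - W - v)\<close> against the probability measure \<open>gibbs N V\<close>, Jensen's inequality replaces \<open>W\<close> by the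
  integrated cost and \<open>v - V\<close> by its mean.\<close>

lemma update_lower:
  assumes v: "v \<in> borel_measurable N" "integrable (gibbs N V) v" and fin: "partition_fun N W v x < \<infinity>"
  shows "U x - cost_V N V W x - ((\<integral>y. v y \<partial>gibbs N V) - (\<integral>y. V y \<partial>gibbs N V)) \<le> sinkhorn_update N U W v x"
proof -
  interpret sw: cost_pair N M V U "\<lambda>y x. W x y" C \<delta> NY NX by (rule swap)
  note [measurable] = V_meas v(1)
  let ?f = "\<lambda>y. V y - W x y - v y"
  have int: "integrable (gibbs N V) ?f" using v W_int_V sw.integrable_U by auto
  have "ennreal (exp (\<integral>y. ?f y \<partial>gibbs N V)) \<le> (\<integral>\<^sup>+ y. ennreal (exp (?f y)) \<partial>gibbs N V)"
    by (rule exp_integral_le_nn_integral_exp[OF prob_V int])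
  also have "\<dots> = partition_fun N W v x"
    by (subst nn_integral_gibbs) (auto simp: partition_fun_eq simp flip: ennreal_mult' exp_add intro!: nn_integral_cong)
  also have "\<dots> = ennreal (exp (sinkhorn_update N U W v x - U x))"
    by (rule partition_fun_update(2)[OF v(1) fin])
  finally have "(\<integral>y. ?f y \<partial>gibbs N V) \<le> sinkhorn_update N U W v x - U x" by simp
  moreover have "(\<integral>y. ?f y \<partial>gibbs N V) = (\<integral>y. V y \<partial>gibbs N V) - cost_V N V W x - (\<integral>y. v y \<partial>gibbs N V)"
    using v W_int_V sw.integrable_U by (simp add: cost_V_def)
  ultimately show ?thesis by simp
qed

section \<open>The Gibbs kernel of a potential\<close>


lemma gibbs_kernel_eq:
  assumes [measurable]: "v \<in> borel_measurable N"
  shows "gibbs_kernel N W v x = density N (\<lambda>y. ennreal (exp (- W x y - v y)) / partition_fun N W v x)"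
  unfolding gibbs_kernel_def kernel_Q_def
  by (subst density_density_eq)
    (auto simp: ennreal_times_divide exp_diff exp_minus divide_inverse simp flip: ennreal_mult')

lemma sets_gibbs_kernel [simp, measurable_cong]: "sets (gibbs_kernel N W v x) = sets N"
  and space_gibbs_kernel [simp]: "space (gibbs_kernel N W v x) = space N"
  by (simp_all add: gibbs_kernel_def kernel_Q_def)

text \<open>At points with infinite normalising constant the kernel is the zero measure, because division by
  \<open>\<infinity>\<close> gives 0. So it is a sub-probability kernel everywhere and measurable as such, and the monadic
  bind is meaningful.\<close>

lemma emeasure_gibbs_kernel_space:
  assumes [measurable]: "v \<in> borel_measurable N"
  shows "emeasure (gibbs_kernel N W v x) (space N) = (if partition_fun N W v x < \<infinity> then 1 else 0)"
proof -
  have "emeasure (gibbs_kernel N W v x) (space N)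
      = (\<integral>\<^sup>+ y. ennreal (exp (- W x y - v y)) / partition_fun N W v x * indicator (space N) y \<partial>N)"
    unfolding gibbs_kernel_eq[OF assms] by (rule emeasure_density) auto
  also have "\<dots> = (\<integral>\<^sup>+ y. ennreal (exp (- W x y - v y)) / partition_fun N W v x \<partial>N)"
    by (rule nn_integral_cong) auto
  also have "\<dots> = (\<integral>\<^sup>+ y. ennreal (exp (- W x y - v y)) \<partial>N) / partition_fun N W v x"
    by (rule nn_integral_divide) auto
  also have "\<dots> = partition_fun N W v x / partition_fun N W v x" by (simp add: partition_fun_eq)
  also have "\<dots> = (if partition_fun N W v x < \<infinity> then 1 else 0)"
  proof (cases "partition_fun N W v x < \<infinity>")
    case True
    then show ?thesis using partition_fun_pos[OF assms, of x] by (simp add: ennreal_divide_self)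
  next
    case False
    then have "partition_fun N W v x = \<infinity>" unfolding infinity_ennreal_def by (metis top.not_eq_extremum)
    then show ?thesis by simp
  qed
  finally show ?thesis .
qed

lemma prob_gibbs_kernel:
  "v \<in> borel_measurable N \<Longrightarrow> partition_fun N W v x < \<infinity> \<Longrightarrow> prob_space (gibbs_kernel N W v x)"
  by (intro prob_spaceI) (simp add: emeasure_gibbs_kernel_space)

lemma gibbs_kernel_density:
  assumes [measurable]: "v \<in> borel_measurable N" and fin: "partition_fun N W v x < \<infinity>"
  shows "gibbs_kernel N W v x = density N (\<lambda>y. ennreal (gibbs_density N W v x y))"
proof -
  let ?z = "enn2real (partition_fun N W v x)"
  have pos: "0 < ?z" by (rule partition_fun_update(3)[OF assms])
  have "partition_fun N W v x = ennreal ?z" using fin by (simp add: ennreal_enn2real)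
  then have "ennreal (exp (- W x y - v y)) / partition_fun N W v x = ennreal (gibbs_density N W v x y)" for y
    using pos unfolding gibbs_density_def by (metis divide_ennreal exp_ge_zero)
  then show ?thesis by (simp add: gibbs_kernel_eq)
qed

lemma gibbs_density_measurable [measurable]:
  "v \<in> borel_measurable N \<Longrightarrow> gibbs_density N W v x \<in> borel_measurable N"
  unfolding gibbs_density_def[abs_def] divide_inverse
  by (intro borel_measurable_times borel_measurable_const) measurable

lemma gibbs_density_nonneg: "0 \<le> gibbs_density N W v x y"
  by (simp add: gibbs_density_def)

lemma gibbs_density_integral:
  assumes v[measurable]: "v \<in> borel_measurable N" and fin: "partition_fun N W v x < \<infinity>"
  shows "integrable N (gibbs_density N W v x)" "(\<integral>y. gibbs_density N W v x y \<partial>N) = 1"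
proof -
  have "emeasure (gibbs_kernel N W v x) (space N) = 1"
    using fin by (simp add: emeasure_gibbs_kernel_space)
  then have nn: "(\<integral>\<^sup>+ y. ennreal (gibbs_density N W v x y) \<partial>N) = 1"
    unfolding gibbs_kernel_density[OF v fin] by (subst (asm) emeasure_density) (auto cong: nn_integral_cong)
  show int: "integrable N (gibbs_density N W v x)"
    by (rule integrableI_nonneg) (auto simp: nn gibbs_density_nonneg)
  have "ennreal (\<integral>y. gibbs_density N W v x y \<partial>N) = 1"
    using nn by (subst (asm) nn_integral_eq_integral[OF int]) (auto simp: gibbs_density_nonneg)
  then show "(\<integral>y. gibbs_density N W v x y \<partial>N) = 1" by simp
qed

lemma gibbs_kernel_measurable:
  assumes v[measurable]: "v \<in> borel_measurable N"
  shows "gibbs_kernel N W v \<in> measurable M (subprob_algebra N)"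
proof (rule measurable_subprob_algebra)
  interpret sigma_finite_measure N by (rule sigma_finite_N)
  have W[measurable]: "(\<lambda>z. W (fst z) (snd z)) \<in> borel_measurable (M \<Otimes>\<^sub>M N)"
    using W_meas by (simp add: case_prod_beta')
  show "subprob_space (gibbs_kernel N W v x)" for x
    using emeasure_gibbs_kernel_space[OF v, of x] by (intro subprob_spaceI) (auto simp: space_N)
  fix A assume [measurable]: "A \<in> sets N"
  have eq: "emeasure (gibbs_kernel N W v x) A
     = (\<integral>\<^sup>+ y. ennreal (exp (- W x y - v y)) * indicator A y \<partial>N) / partition_fun N W v x" for x
  proof -
    have "emeasure (gibbs_kernel N W v x) A
        = (\<integral>\<^sup>+ y. ennreal (exp (- W x y - v y)) / partition_fun N W v x * indicator A y \<partial>N)"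
      unfolding gibbs_kernel_eq[OF v] by (rule emeasure_density) auto
    also have "\<dots> = (\<integral>\<^sup>+ y. (ennreal (exp (- W x y - v y)) * indicator A y) / partition_fun N W v x \<partial>N)"
      by (intro nn_integral_cong) (simp add: divide_ennreal_def mult_ac)
    also have "\<dots> = (\<integral>\<^sup>+ y. ennreal (exp (- W x y - v y)) * indicator A y \<partial>N) / partition_fun N W v x"
      by (rule nn_integral_divide) auto
    finally show ?thesis .
  qed
  have "(\<lambda>x. \<integral>\<^sup>+ y. ennreal (exp (- W x y - v y)) * indicator A y \<partial>N) \<in> borel_measurable M"
    by (rule borel_measurable_nn_integral) (simp add: case_prod_beta')
  then show "(\<lambda>x. emeasure (gibbs_kernel N W v x) A) \<in> borel_measurable M"
    unfolding eq by (intro borel_measurable_divide_ennreal partition_fun_measurable v)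
qed simp

text \<open>With \<open>u\<close> the update of \<open>v\<close>, the joint law of the starting point and the next point has density
  \<open>exp (- u(x) - W(x,y) - v(y))\<close>. Integrating out \<open>x\<close> produces the normalising constant of the
  opposite half-step, that is, \<open>exp (v' - V)\<close> with the next potential \<open>v'\<close>.\<close>

lemma bind_gibbs_kernel:
  assumes v: "v \<in> borel_measurable N"
    and fin_v: "AE x in M. partition_fun N W v x < \<infinity>"
    and fin_u: "AE y in N. partition_fun M (\<lambda>y x. W x y) (sinkhorn_update N U W v) y < \<infinity>"
  shows "Giry_Monad.bind (gibbs M U) (gibbs_kernel N W v) = density (gibbs N V)
     (\<lambda>y. ennreal (exp (sinkhorn_update M V (\<lambda>y x. W x y) (sinkhorn_update N U W v) y - v y)))"
proof -
  interpret sw: cost_pair N M V U "\<lambda>y x. W x y" C \<delta> NY NX by (rule swap)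
  interpret M: sigma_finite_measure M by (rule sigma_finite_M)
  interpret N: sigma_finite_measure N by (rule sigma_finite_N)
  interpret MN: pair_sigma_finite M N ..
  define u where "u = sinkhorn_update N U W v"
  define v' where "v' = sinkhorn_update M V (\<lambda>y x. W x y) u"
  have u: "u \<in> borel_measurable M" unfolding u_def by (rule sinkhorn_update_measurable[OF v U_meas])
  have v': "v' \<in> borel_measurable N" unfolding v'_def by (rule sw.sinkhorn_update_measurable[OF u V_meas])
  note [measurable] = v u v' U_meas V_meas
  have W[measurable]: "(\<lambda>z. W (fst z) (snd z)) \<in> borel_measurable (M \<Otimes>\<^sub>M N)"
    using W_meas by (simp add: case_prod_beta')
  have ne: "space (gibbs M U) \<noteq> {}" by (simp add: space_M)
  have km: "gibbs_kernel N W v \<in> gibbs M U \<rightarrow>\<^sub>M subprob_algebra N"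
    using gibbs_kernel_measurable[OF v] by (simp add: measurable_cong_sets[OF sets_gibbs refl])
  show ?thesis unfolding u_def[symmetric] v'_def[symmetric]
  proof (rule measure_eqI)
    show sets: "sets (gibbs M U \<bind> gibbs_kernel N W v) = sets (density (gibbs N V) (\<lambda>y. ennreal (exp (v' y - v y))))"
      using ne by (subst sets_bind) auto
    fix A assume "A \<in> sets (gibbs M U \<bind> gibbs_kernel N W v)"
    then have A[measurable]: "A \<in> sets N" unfolding sets by simp
    have "emeasure (gibbs M U \<bind> gibbs_kernel N W v) A = (\<integral>\<^sup>+ x. emeasure (gibbs_kernel N W v x) A \<partial>gibbs M U)"
      by (rule emeasure_bind[OF ne km A])
    also have "\<dots> = (\<integral>\<^sup>+ x. ennreal (exp (- U x)) * emeasure (gibbs_kernel N W v x) A \<partial>M)"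
      using measurable_emeasure_kernel[OF gibbs_kernel_measurable[OF v] A] by (intro nn_integral_gibbs) auto
    also have "\<dots> = (\<integral>\<^sup>+ x. (\<integral>\<^sup>+ y. ennreal (exp (- W x y - v y - u x)) * indicator A y \<partial>N) \<partial>M)"
    proof (rule nn_integral_cong_AE)
      show "AE x in M. ennreal (exp (- U x)) * emeasure (gibbs_kernel N W v x) A
          = (\<integral>\<^sup>+ y. ennreal (exp (- W x y - v y - u x)) * indicator A y \<partial>N)"
        using fin_v
      proof eventually_elim
        case (elim x)
        have dens: "exp (- U x) * gibbs_density N W v x y = exp (- W x y - v y - u x)" for y
          unfolding gibbs_density_def partition_fun_update(1)[OF v elim, of U] u_def[symmetric]
          by (simp add: exp_diff exp_minus exp_add field_simps)
        have "emeasure (gibbs_kernel N W v x) A = (\<integral>\<^sup>+ y. ennreal (gibbs_density N W v x y) * indicator A y \<partial>N)"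
          unfolding gibbs_kernel_density[OF v elim] by (rule emeasure_density) auto
        then have "ennreal (exp (- U x)) * emeasure (gibbs_kernel N W v x) A
            = (\<integral>\<^sup>+ y. ennreal (exp (- U x)) * (ennreal (gibbs_density N W v x y) * indicator A y) \<partial>N)"
          by (subst nn_integral_cmult) auto
        also have "\<dots> = (\<integral>\<^sup>+ y. ennreal (exp (- W x y - v y - u x)) * indicator A y \<partial>N)"
          by (intro nn_integral_cong)
            (simp add: dens[symmetric] ennreal_mult' gibbs_density_nonneg mult.assoc)
        finally show ?case .
      qed
    qed
    also have "\<dots> = (\<integral>\<^sup>+ y. (\<integral>\<^sup>+ x. ennreal (exp (- W x y - v y - u x)) * indicator A y \<partial>M) \<partial>N)"
      by (rule MN.Fubini'[symmetric]) (simp add: case_prod_beta')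
    also have "\<dots> = (\<integral>\<^sup>+ y. ennreal (exp (- V y)) * (ennreal (exp (v' y - v y)) * indicator A y) \<partial>N)"
    proof (rule nn_integral_cong_AE)
      show "AE y in N. (\<integral>\<^sup>+ x. ennreal (exp (- W x y - v y - u x)) * indicator A y \<partial>M)
          = ennreal (exp (- V y)) * (ennreal (exp (v' y - v y)) * indicator A y)"
        using fin_u
      proof eventually_elim
        case (elim y)
        then have fin: "partition_fun M (\<lambda>y x. W x y) u y < \<infinity>" by (simp add: u_def)
        have [measurable]: "(\<lambda>x. W x y) \<in> borel_measurable M" using sw.W_section by simp
        have "(\<integral>\<^sup>+ x. ennreal (exp (- W x y - v y - u x)) * indicator A y \<partial>M)
            = (\<integral>\<^sup>+ x. (ennreal (exp (- v y)) * indicator A y) * ennreal (exp (- W x y - u x)) \<partial>M)"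
          by (intro nn_integral_cong) (simp add: indicator_def flip: ennreal_mult' exp_add)
        also have "\<dots> = (ennreal (exp (- v y)) * indicator A y) * partition_fun M (\<lambda>y x. W x y) u y"
          by (subst nn_integral_cmult) (auto simp: sw.partition_fun_eq[OF u])
        also have "\<dots> = (ennreal (exp (- v y)) * indicator A y) * ennreal (exp (v' y - V y))"
          unfolding sw.partition_fun_update(2)[OF u fin, of V] v'_def ..
        also have "\<dots> = ennreal (exp (- V y)) * (ennreal (exp (v' y - v y)) * indicator A y)"
          by (simp add: indicator_def flip: ennreal_mult' exp_add)
        finally show ?case .
      qed
    qed
    also have "\<dots> = (\<integral>\<^sup>+ y. ennreal (exp (v' y - v y)) * indicator A y \<partial>gibbs N V)"
      by (rule nn_integral_gibbs[symmetric]) auto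
    also have "\<dots> = emeasure (density (gibbs N V) (\<lambda>y. ennreal (exp (v' y - v y)))) A"
      by (rule emeasure_density[symmetric]) auto
    finally show "emeasure (gibbs M U \<bind> gibbs_kernel N W v) A
        = emeasure (density (gibbs N V) (\<lambda>y. ennreal (exp (v' y - v y)))) A" .
  qed
qed

lemma bind_gibbs_kernel_mass:
  assumes v: "v \<in> borel_measurable N" and fin: "AE x in M. partition_fun N W v x < \<infinity>"
  shows "prob_space (Giry_Monad.bind (gibbs M U) (gibbs_kernel N W v))"
proof -
  interpret prob_space "gibbs M U" by (rule prob_U)
  have "gibbs_kernel N W v \<in> gibbs M U \<rightarrow>\<^sub>M subprob_algebra N"
    using gibbs_kernel_measurable[OF v] by (simp add: measurable_cong_sets[OF sets_gibbs refl])
  moreover have "AE x in gibbs M U. prob_space (gibbs_kernel N W v x)"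
    unfolding AE_gibbs[OF U_meas] using fin by eventually_elim (rule prob_gibbs_kernel[OF v])
  ultimately show ?thesis by (intro prob_space_bind)
qed

text \<open>The quotient of the two normalising constants is the integral of \<open>exp (v - v')\<close> against the Gibbs
  kernel of \<open>v\<close>; apply Jensen. Exchanging \<open>v\<close> and \<open>v'\<close> gives the matching upper bound, with the
  kernel of \<open>v'\<close> instead.\<close>

lemma update_gain:
  assumes v: "v \<in> borel_measurable N" and v': "v' \<in> borel_measurable N"
    and fin: "partition_fun N W v x < \<infinity>" "partition_fun N W v' x < \<infinity>"
    and int: "integrable N (\<lambda>y. (v' y - v y) * gibbs_density N W v x y)"
  shows "- (\<integral>y. (v' y - v y) * gibbs_density N W v x y \<partial>N)
    \<le> sinkhorn_update N U W v' x - sinkhorn_update N U W v x"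
proof -
  note [measurable] = v v'
  let ?P = "gibbs_kernel N W v x" and ?p = "gibbs_density N W v x"
  note P_eq = gibbs_kernel_density[OF v fin(1)]
  have flip: "(\<lambda>y. ?p y * (v y - v' y)) = (\<lambda>y. - ((v' y - v y) * ?p y))"
    by (simp add: algebra_simps)
  have nn: "AE y in N. 0 \<le> ?p y" by (simp add: gibbs_density_nonneg)
  have intP: "integrable ?P (\<lambda>y. v y - v' y)"
    unfolding P_eq by (subst integrable_real_density[OF _ nn]) (auto simp: flip int)
  have eqP: "(\<integral>y. v y - v' y \<partial>?P) = - (\<integral>y. (v' y - v y) * ?p y \<partial>N)"
    unfolding P_eq by (subst integral_real_density[OF _ nn]) (auto simp: flip)
  have "ennreal (exp (\<integral>y. v y - v' y \<partial>?P)) \<le> (\<integral>\<^sup>+ y. ennreal (exp (v y - v' y)) \<partial>?P)"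
    by (rule exp_integral_le_nn_integral_exp[OF prob_gibbs_kernel[OF v fin(1)] intP])
  also have "\<dots> = (\<integral>\<^sup>+ y. ennreal (?p y) * ennreal (exp (v y - v' y)) \<partial>N)"
    unfolding P_eq by (rule nn_integral_density) auto
  also have "\<dots> = (\<integral>\<^sup>+ y. ennreal (exp (- W x y - v' y)) * ennreal (exp (- (sinkhorn_update N U W v x - U x))) \<partial>N)"
    by (intro nn_integral_cong)
      (simp add: gibbs_density_def partition_fun_update(1)[OF v fin(1), of U] divide_inverse
        flip: ennreal_mult' exp_add exp_minus)
  also have "\<dots> = partition_fun N W v' x * ennreal (exp (- (sinkhorn_update N U W v x - U x)))"
    by (subst nn_integral_multc) (auto simp: partition_fun_eq[OF v'])
  also have "\<dots> = ennreal (exp (sinkhorn_update N U W v' x - sinkhorn_update N U W v x))"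
    unfolding partition_fun_update(2)[OF v' fin(2), of U] by (simp flip: ennreal_mult' exp_add)
  finally show ?thesis unfolding eqP by simp
qed

section \<open>Drift, minorisation and contraction of one half-step\<close>


abbreviation adm :: "real \<Rightarrow> real \<Rightarrow> ('b \<Rightarrow> real) \<Rightarrow> bool" where
  "adm \<equiv> admissible M N U V W NX NY"

lemma tempered_AE_lower:
  assumes "tempered N V (cost_V M U (\<lambda>y x. W x y)) NY k l v"
  shows "AE y in N. V y - cost_V M U (\<lambda>y x. W x y) y - k \<le> v y"
  using AE_not_in[OF null_Y] by eventually_elim (use assms in \<open>auto simp: tempered_def\<close>)

lemma tempered_measurable: "tempered N' V' b E k l v \<Longrightarrow> v \<in> borel_measurable N'"
  by (simp add: tempered_def)

lemma partition_fun_finite: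
  assumes "tempered N V (cost_V M U (\<lambda>y x. W x y)) NY k l v" "x \<notin> NX"
  shows "partition_fun N W v x < \<infinity>"
proof -
  obtain L where L: "\<And>k v x. v \<in> borel_measurable N \<Longrightarrow>
     (AE y in N. V y - cost_V M U (\<lambda>y x. W x y) y - k \<le> v y) \<Longrightarrow> x \<notin> NX \<Longrightarrow>
     partition_fun N W v x \<le> ennreal (exp (L + k))"
    using partition_fun_le by blast
  show ?thesis
    using L[OF tempered_measurable[OF assms(1)] tempered_AE_lower[OF assms(1)] assms(2)]
    by (rule le_less_trans) simp
qed

text \<open>The constants do not deteriorate along the iteration: \<open>k\<close> is preserved as long as the means stay
  below \<open>k\<close>, and the new upper constant depends on \<open>k\<close> only, not on the previous \<open>l\<close>.\<close>

lemma update_tempered: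
  "\<exists>L. \<forall>k l v. tempered N V (cost_V M U (\<lambda>y x. W x y)) NY k l v \<longrightarrow>
     (\<integral>y. v y \<partial>gibbs N V) - (\<integral>y. V y \<partial>gibbs N V) \<le> k \<longrightarrow>
     tempered M U (cost_V N V W) NX k (L + k) (sinkhorn_update N U W v)"
proof -
  interpret sw: cost_pair N M V U "\<lambda>y x. W x y" C \<delta> NY NX by (rule swap)
  obtain L where L: "\<And>k v x. v \<in> borel_measurable N \<Longrightarrow>
     (AE y in N. V y - cost_V M U (\<lambda>y x. W x y) y - k \<le> v y) \<Longrightarrow> x \<notin> NX \<Longrightarrow>
     partition_fun N W v x \<le> ennreal (exp (L + k))"
    using partition_fun_le by blast
  have "tempered M U (cost_V N V W) NX k (L + k) (sinkhorn_update N U W v)"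
    if v: "tempered N V (cost_V M U (\<lambda>y x. W x y)) NY k l v"
      and mean: "(\<integral>y. v y \<partial>gibbs N V) - (\<integral>y. V y \<partial>gibbs N V) \<le> k" for k l v
    unfolding tempered_def
  proof (intro conjI allI impI)
    note vm = tempered_measurable[OF v]
    show "sinkhorn_update N U W v \<in> borel_measurable M"
      by (rule sinkhorn_update_measurable[OF vm U_meas])
    fix x assume x: "x \<notin> NX"
    note fin = partition_fun_finite[OF v x]
    show "U x - cost_V N V W x - k \<le> sinkhorn_update N U W v x"
      using update_lower[OF vm sw.integrable_tempered[OF v] fin] mean by linarith
    have "partition_fun N W v x \<le> ennreal (exp (L + k))"
      by (rule L[OF vm tempered_AE_lower[OF v] x])
    then have "exp (sinkhorn_update N U W v x - U x) \<le> exp (L + k)"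
      unfolding partition_fun_update(2)[OF vm fin, of U] by simp
    then show "sinkhorn_update N U W v x \<le> U x + (L + k)" by simp
  qed
  then show ?thesis by (intro exI allI impI)
qed

text \<open>For admissible \<open>v\<close> the density times \<open>exp (\<delta> V)\<close> is at most a constant times
  \<open>exp (W\<^sup>V(x)) exp (W\<^sub>U(y) - (1 - \<delta>) V(y))\<close>. The \<open>y\<close>-factor has a finite integral, and the \<open>x\<close>-factor is
  negligible against \<open>exp (\<delta> U(x))\<close>. The reference levels \<open>mU\<close> and \<open>mV\<close> only change constants.\<close>

lemma kernel_drift:
  assumes \<epsilon>: "0 < \<epsilon>"
  shows "\<exists>c>0. \<forall>v x. adm k l v \<longrightarrow> x \<notin> NX \<longrightarrow>
    kapp (gibbs_kernel N W v) (\<lambda>y. exp (\<delta> * (V y - mV))) x \<le> ennreal (\<epsilon> * exp (\<delta> * (U x - mU)) + c)"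
proof -
  interpret sw: cost_pair N M V U "\<lambda>y x. W x y" C \<delta> NY NX by (rule swap)
  note [measurable] = V_meas
  let ?a = "cost_V N V W" and ?b = "cost_V M U (\<lambda>y x. W x y)"
  define I where "I = enn2real (\<integral>\<^sup>+ y. ennreal (exp (?b y - (1 - \<delta>) * V y)) \<partial>N)"
  have I: "(\<integral>\<^sup>+ y. ennreal (exp (?b y - (1 - \<delta>) * V y)) \<partial>N) = ennreal I" "0 \<le> I"
    using sw.exp_cost_finite by (auto simp: I_def)
  define K where "K = C * exp (2 * k - \<delta> * mV) * I"
  have K: "0 \<le> K" using C_pos I by (simp add: K_def)
  define \<epsilon>' where "\<epsilon>' = \<epsilon> * exp (- \<delta> * mU) / (K + 1)"
  have "0 < \<epsilon>'" using \<epsilon> K by (simp add: \<epsilon>'_def)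
  then obtain c where c: "\<And>x. exp (?a x) \<le> \<epsilon>' * exp (\<delta> * U x) + c" using cost_growth_X by blast
  have bound: "K * exp (?a x) \<le> \<epsilon> * exp (\<delta> * (U x - mU)) + (K * \<bar>c\<bar> + 1)" for x
  proof -
    have "K * exp (?a x) \<le> K * (\<epsilon>' * exp (\<delta> * U x) + \<bar>c\<bar>)"
      using c[of x] K by (intro mult_left_mono) auto
    moreover have "K * \<epsilon>' \<le> \<epsilon> * exp (- \<delta> * mU)"
      using K \<epsilon> by (simp add: \<epsilon>'_def field_simps)
    then have "K * \<epsilon>' * exp (\<delta> * U x) \<le> \<epsilon> * exp (- \<delta> * mU) * exp (\<delta> * U x)"
      by (intro mult_right_mono) auto
    moreover have "\<epsilon> * exp (- \<delta> * mU) * exp (\<delta> * U x) = \<epsilon> * exp (\<delta> * (U x - mU))"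
      by (simp add: right_diff_distrib flip: exp_add)
    moreover have "K * (\<epsilon>' * exp (\<delta> * U x) + \<bar>c\<bar>) = K * \<epsilon>' * exp (\<delta> * U x) + K * \<bar>c\<bar>"
      by (simp add: algebra_simps)
    ultimately show ?thesis by linarith
  qed
  have "kapp (gibbs_kernel N W v) (\<lambda>y. exp (\<delta> * (V y - mV))) x
      \<le> ennreal (\<epsilon> * exp (\<delta> * (U x - mU)) + (K * \<bar>c\<bar> + 1))"
    if adm: "adm k l v" and x: "x \<notin> NX" for v x
  proof -
    have v: "tempered N V ?b NY k l v" and u: "tempered M U ?a NX k l (sinkhorn_update N U W v)"
      using adm by (auto simp: admissible_def)
    note vm[measurable] = tempered_measurable[OF v]
    note fin = partition_fun_finite[OF v x]
    have "kapp (gibbs_kernel N W v) (\<lambda>y. exp (\<delta> * (V y - mV))) x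
        = (\<integral>\<^sup>+ y. ennreal (gibbs_density N W v x y) * ennreal (exp (\<delta> * (V y - mV))) \<partial>N)"
      unfolding kapp_def gibbs_kernel_density[OF vm fin] by (rule nn_integral_density) auto
    also have "\<dots> \<le> (\<integral>\<^sup>+ y. ennreal (C * exp (2 * k - \<delta> * mV) * exp (?a x)) * ennreal (exp (?b y - (1 - \<delta>) * V y)) \<partial>N)"
    proof (rule nn_integral_mono_AE)
      show "AE y in N. ennreal (gibbs_density N W v x y) * ennreal (exp (\<delta> * (V y - mV)))
        \<le> ennreal (C * exp (2 * k - \<delta> * mV) * exp (?a x)) * ennreal (exp (?b y - (1 - \<delta>) * V y))"
        using W_bound_X[OF x] tempered_AE_lower[OF v]
      proof eventually_elim
        case (elim y)
        have ux: "U x - ?a x - k \<le> sinkhorn_update N U W v x" using u x by (auto simp: tempered_def)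
        have "gibbs_density N W v x y * exp (\<delta> * (V y - mV))
            = exp (- W x y) * exp (- v y - (sinkhorn_update N U W v x - U x) + \<delta> * (V y - mV))"
          unfolding gibbs_density_def partition_fun_update(1)[OF vm fin, of U]
          by (simp only: flip: exp_add exp_diff) (simp add: algebra_simps)
        also have "\<dots> \<le> C * exp ((2 * k - \<delta> * mV) + ?a x + (?b y - (1 - \<delta>) * V y))"
        proof (rule mult_mono)
          show "exp (- v y - (sinkhorn_update N U W v x - U x) + \<delta> * (V y - mV))
              \<le> exp ((2 * k - \<delta> * mV) + ?a x + (?b y - (1 - \<delta>) * V y))"
            using ux elim(2) by (simp add: algebra_simps)
        qed (use elim C_pos in auto)
        also have "\<dots> = C * exp (2 * k - \<delta> * mV) * exp (?a x) * exp (?b y - (1 - \<delta>) * V y)"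
          by (simp only: exp_add mult.assoc)
        finally have "ennreal (gibbs_density N W v x y * exp (\<delta> * (V y - mV)))
            \<le> ennreal (C * exp (2 * k - \<delta> * mV) * exp (?a x) * exp (?b y - (1 - \<delta>) * V y))"
          by (rule ennreal_leI)
        then show ?case using C_pos by (simp add: ennreal_mult gibbs_density_nonneg)
      qed
    qed
    also have "\<dots> = ennreal (C * exp (2 * k - \<delta> * mV) * exp (?a x)) * ennreal I"
      by (subst nn_integral_cmult) (auto simp: I)
    also have "\<dots> = ennreal (K * exp (?a x))"
      using I C_pos by (subst ennreal_mult[symmetric]) (auto simp: K_def mult_ac)
    also have "\<dots> \<le> ennreal (\<epsilon> * exp (\<delta> * (U x - mU)) + (K * \<bar>c\<bar> + 1))"
      by (intro ennreal_leI bound)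
    finally show ?thesis .
  qed
  moreover have "0 < K * \<bar>c\<bar> + 1" using K by (simp add: add_nonneg_pos)
  ultimately show ?thesis by (intro exI[of _ "K * \<bar>c\<bar> + 1"] conjI allI impI)
qed

lemma integral_le_of_kapp:
  assumes v: "v \<in> borel_measurable N" and fin: "partition_fun N W v x < \<infinity>"
    and w[measurable]: "w \<in> borel_measurable N" and w0: "\<And>y. 0 \<le> w y"
    and le: "kapp (gibbs_kernel N W v) w x \<le> ennreal B" and B: "0 \<le> B"
  shows "integrable N (\<lambda>y. w y * gibbs_density N W v x y)"
    and "(\<integral>y. w y * gibbs_density N W v x y \<partial>N) \<le> B"
proof -
  note [measurable] = v
  have "kapp (gibbs_kernel N W v) w x = (\<integral>\<^sup>+ y. ennreal (gibbs_density N W v x y) * ennreal (w y) \<partial>N)"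
    unfolding kapp_def gibbs_kernel_density[OF v fin] by (rule nn_integral_density) auto
  also have "\<dots> = (\<integral>\<^sup>+ y. ennreal (w y * gibbs_density N W v x y) \<partial>N)"
    using w0 gibbs_density_nonneg by (intro nn_integral_cong) (simp add: mult.commute flip: ennreal_mult)
  finally have nn: "(\<integral>\<^sup>+ y. ennreal (w y * gibbs_density N W v x y) \<partial>N) \<le> ennreal B" using le by simp
  have pos: "AE y in N. 0 \<le> w y * gibbs_density N W v x y" using w0 gibbs_density_nonneg by auto
  show int: "integrable N (\<lambda>y. w y * gibbs_density N W v x y)"
    using nn pos by (intro integrableI_nonneg) (auto intro: le_less_trans)
  have "ennreal (\<integral>y. w y * gibbs_density N W v x y \<partial>N) \<le> ennreal B"
    using nn by (subst (asm) nn_integral_eq_integral[OF int pos])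
  then show "(\<integral>y. w y * gibbs_density N W v x y \<partial>N) \<le> B" using B by simp
qed

text \<open>The upper bounds on \<open>v\<close> and on its update bound the density below by
  \<open>exp (- W - V - 2 l)\<close>, and \<open>W\<close> is bounded above by \<open>w\<close> while \<open>U x \<le> r\<close> and \<open>y\<close> stays in
  the set \<open>B\<close>. The function \<open>q\<close> depends on neither \<open>v\<close> nor \<open>x\<close>, which is what allows kernels of different
  iterates to be compared.\<close>

lemma kernel_minorised:
  "\<exists>\<alpha> q. 0 < \<alpha> \<and> integrable N q \<and> (\<forall>y. 0 \<le> q y) \<and> \<alpha> \<le> (\<integral>y. q y \<partial>N) \<and>
    (\<forall>v x. adm k l v \<longrightarrow> x \<notin> NX \<longrightarrow> U x \<le> r \<longrightarrow> (AE y in N. q y \<le> gibbs_density N W v x y))"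
proof -
  interpret V: prob_space "gibbs N V" by (rule prob_V)
  note [measurable] = V_meas
  obtain B where B[measurable]: "B \<in> sets N" and Bpos: "0 < measure (gibbs N V) B"
    and "\<forall>r. \<exists>w. \<forall>x y. U x \<le> r \<longrightarrow> y \<in> B \<longrightarrow> W x y \<le> w" using small_Y by blast
  then obtain w where w: "\<And>x y. U x \<le> r \<Longrightarrow> y \<in> B \<Longrightarrow> W x y \<le> w" by blast
  define q where "q y = exp (- V y) * (exp (- w - 2 * l) * indicator B y)" for y
  have int: "integrable (gibbs N V) (\<lambda>y. exp (- w - 2 * l) * indicator B y :: real)"
    by (intro integrable_mult_right integrable_real_indicator) (auto simp: V.emeasure_eq_measure)
  have nn: "AE y in N. 0 \<le> exp (- V y)" by simp
  have q_int: "integrable N q"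
    using int unfolding gibbs_def q_def by (subst (asm) integrable_real_density[OF _ nn]) auto
  have "(\<integral>y. q y \<partial>N) = (\<integral>y. exp (- w - 2 * l) * indicator B y \<partial>gibbs N V)"
    unfolding gibbs_def q_def by (subst integral_real_density[OF _ nn]) auto
  also have "\<dots> = exp (- w - 2 * l) * measure (gibbs N V) B"
    using B by (simp add: sets.Int_space_eq2)
  finally have mass: "(\<integral>y. q y \<partial>N) = exp (- w - 2 * l) * measure (gibbs N V) B" .
  have "AE y in N. q y \<le> gibbs_density N W v x y"
    if adm: "adm k l v" and x: "x \<notin> NX" "U x \<le> r" for v x
    using AE_not_in[OF null_Y]
  proof eventually_elim
    case (elim y)
    have v: "tempered N V (cost_V M U (\<lambda>y x. W x y)) NY k l v"
      and u: "tempered M U (cost_V N V W) NX k l (sinkhorn_update N U W v)"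
      using adm by (auto simp: admissible_def)
    have le: "v y \<le> V y + l" "sinkhorn_update N U W v x \<le> U x + l"
      using u v x elim by (auto simp: tempered_def)
    show ?case
    proof (cases "y \<in> B")
      case True
      have "q y = exp (- V y + (- w - 2 * l))" unfolding q_def exp_add using True by simp
      also have "\<dots> \<le> exp (- W x y - v y - (sinkhorn_update N U W v x - U x))"
        using le w[OF x(2) True] by simp
      also have "\<dots> = gibbs_density N W v x y"
        unfolding gibbs_density_def
          partition_fun_update(1)[OF tempered_measurable[OF v] partition_fun_finite[OF v x(1)], of U]
        by (simp only: exp_diff)
      finally show ?thesis .
    qed (simp add: q_def gibbs_density_nonneg)
  qed
  moreover have "0 < exp (- w - 2 * l) * measure (gibbs N V) B" using Bpos by simp
  ultimately show ?thesis using q_int mass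
    by (intro exI[of _ "exp (- w - 2 * l) * measure (gibbs N V) B"] exI[of _ q]) (auto simp: q_def)
qed

text \<open>By \<open>update_gain\<close> the increment \<open>g\<close> of the updates is squeezed between \<open>- S(h)\<close> and \<open>- S'(h)\<close> for the
  kernels \<open>S\<close>, \<open>S'\<close> of \<open>v\<close>, \<open>v'\<close>. Hence \<open>g x1 - g x2 \<le> S(h)(x2) - S'(h)(x1)\<close>, which the weighted
  contraction estimates although two different kernels occur.\<close>

lemma update_contracts:
  fixes c \<alpha> D s mU mV
  defines "\<phi> \<equiv> \<lambda>x. exp (\<delta> * (U x - mU))" and "\<psi> \<equiv> \<lambda>y. exp (\<delta> * (V y - mV))"
  assumes drift: "\<And>v x. adm k l v \<Longrightarrow> x \<notin> NX \<Longrightarrow> kapp (gibbs_kernel N W v) \<psi> x \<le> ennreal (\<phi> x / 2 + c)"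
    and minor: "integrable N q" "\<And>y. 0 \<le> q y" "\<alpha> \<le> (\<integral>y. q y \<partial>N)"
      "\<And>v x. adm k l v \<Longrightarrow> x \<notin> NX \<Longrightarrow> \<phi> x \<le> 16 * c \<Longrightarrow> AE y in N. q y \<le> gibbs_density N W v x y"
    and c: "0 < c" and \<alpha>: "0 < \<alpha>" and D: "0 \<le> D"
    and adm: "adm k l v" "adm k l v'"
    and h: "\<And>y. y \<notin> NY \<Longrightarrow> \<bar>v' y - v y - s\<bar> \<le> D * (1 + \<alpha> / (2 * c) * \<psi> y)"
  shows "\<exists>s'. \<forall>x. x \<notin> NX \<longrightarrow> \<bar>sinkhorn_update N U W v' x - sinkhorn_update N U W v x - s'\<bar>
    \<le> max (3/4) (1 - \<alpha> / 2) * D * (1 + \<alpha> / (2 * c) * \<phi> x)"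
proof -
  have v: "v \<in> borel_measurable N" and v': "v' \<in> borel_measurable N"
    using adm by (auto simp: admissible_def tempered_def)
  note [measurable] = v v' V_meas
  have fin: "partition_fun N W v x < \<infinity>" "partition_fun N W v' x < \<infinity>" if "x \<notin> NX" for x
    using adm partition_fun_finite that by (auto simp: admissible_def)
  have \<psi>m[measurable]: "\<psi> \<in> borel_measurable N" unfolding \<psi>_def by measurable
  have pos: "0 < \<phi> x" "0 < \<psi> y" for x y by (auto simp: \<phi>_def \<psi>_def)
  let ?p = "\<lambda>v x. gibbs_density N W v x"
  have contr: "integrable N (\<lambda>y. h y * ?p w x y)"
    "(\<integral>y. h y * ?p w x y \<partial>N) - (\<integral>y. h y * ?p w' x' y \<partial>N)
      \<le> max (3/4) (1 - \<alpha> / 2) * D * ((1 + \<alpha> / (2 * c) * \<phi> x) + (1 + \<alpha> / (2 * c) * \<phi> x'))"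
    if w: "w \<in> {v, v'}" "w' \<in> {v, v'}" "x \<notin> NX" "x' \<notin> NX"
      and h: "h \<in> borel_measurable N" "\<And>y. y \<notin> NY \<Longrightarrow> \<bar>h y - s\<bar> \<le> D * (1 + \<alpha> / (2 * c) * \<psi> y)" for w w' x x' h s
  proof -
    have w_adm: "adm k l w" "adm k l w'" and wm: "w \<in> borel_measurable N" "w' \<in> borel_measurable N"
      and wfin: "partition_fun N W w x < \<infinity>" "partition_fun N W w' x' < \<infinity>"
      using w adm v v' fin by auto
    have B: "0 \<le> \<phi> z / 2 + c" for z using pos(1)[of z] c by simp
    note I = gibbs_density_integral[OF wm(1) wfin(1)] and I' = gibbs_density_integral[OF wm(2) wfin(2)]
    note J = integral_le_of_kapp[OF wm(1) wfin(1) \<psi>m less_imp_le[OF pos(2)] drift[OF w_adm(1) w(3)] B]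
    note J' = integral_le_of_kapp[OF wm(2) wfin(2) \<psi>m less_imp_le[OF pos(2)] drift[OF w_adm(2) w(4)] B]
    have hAE: "AE y in N. \<bar>h y - s\<bar> \<le> D * (1 + \<alpha> / (2 * c) * \<psi> y)"
      using AE_not_in[OF null_Y] by eventually_elim (rule h(2))
    have m: "\<exists>q. integrable N q \<and> (\<forall>y. 0 \<le> q y) \<and> (AE y in N. q y \<le> ?p w x y) \<and>
        (AE y in N. q y \<le> ?p w' x' y) \<and> \<alpha> \<le> (\<integral>y. q y \<partial>N)" if "\<phi> x + \<phi> x' \<le> 16 * c"
      using minor(1-3) minor(4)[OF w_adm(1) w(3)] minor(4)[OF w_adm(2) w(4)] that pos(1)[of x] pos(1)[of x']
      by (intro exI[of _ q]) auto
    note W = weighted_contraction[OF I(1) gibbs_density_nonneg I(2) I'(1) gibbs_density_nonneg I'(2)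
      less_imp_le[OF pos(2)] \<psi>m J J' m less_imp_le[OF pos(1)] less_imp_le[OF pos(1)] \<alpha> c D h(1) hAE]
    show "integrable N (\<lambda>y. h y * ?p w x y)" by (rule W(1))
    show "(\<integral>y. h y * ?p w x y \<partial>N) - (\<integral>y. h y * ?p w' x' y \<partial>N)
      \<le> max (3/4) (1 - \<alpha> / 2) * D * ((1 + \<alpha> / (2 * c) * \<phi> x) + (1 + \<alpha> / (2 * c) * \<phi> x'))"
      by (rule W(2))
  qed
  let ?h = "\<lambda>y. v' y - v y"
  let ?g = "\<lambda>x. sinkhorn_update N U W v' x - sinkhorn_update N U W v x"
  have hm: "?h \<in> borel_measurable N" by simp
  have neg: "(\<lambda>y. (v y - v' y) * r y) = (\<lambda>y. - (?h y * r y))" for r :: "'b \<Rightarrow> real" by (simp add: algebra_simps)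
  have low: "- (\<integral>y. ?h y * ?p v x y \<partial>N) \<le> ?g x" if x: "x \<notin> NX" for x
    by (rule update_gain[OF v v' fin[OF x] contr(1)[OF _ _ x x hm h]]) auto
  have up: "?g x \<le> - (\<integral>y. ?h y * ?p v' x y \<partial>N)" if x: "x \<notin> NX" for x
  proof -
    have "integrable N (\<lambda>y. (v y - v' y) * ?p v' x y)"
      unfolding neg using contr(1)[OF _ _ x x hm h, of v' v] by auto
    from update_gain[OF v' v fin(2,1)[OF x] this] show ?thesis unfolding neg by simp
  qed
  have "?g x1 - ?g x2 \<le> max (3/4) (1 - \<alpha> / 2) * D * (1 + \<alpha> / (2 * c) * \<phi> x1)
      + max (3/4) (1 - \<alpha> / 2) * D * (1 + \<alpha> / (2 * c) * \<phi> x2)" if x: "x1 \<in> - NX" "x2 \<in> - NX" for x1 x2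
  proof -
    have "?g x1 - ?g x2 \<le> (\<integral>y. ?h y * ?p v x2 y \<partial>N) - (\<integral>y. ?h y * ?p v' x1 y \<partial>N)"
      using up[of x1] low[of x2] x by auto
    also have "\<dots> \<le> max (3/4) (1 - \<alpha> / 2) * D * ((1 + \<alpha> / (2 * c) * \<phi> x2) + (1 + \<alpha> / (2 * c) * \<phi> x1))"
      by (rule contr(2)[OF _ _ _ _ hm h]) (use x in auto)
    finally show ?thesis by (simp add: algebra_simps)
  qed
  then have "\<exists>s'. \<forall>x\<in>- NX. \<bar>?g x - s'\<bar> \<le> max (3/4) (1 - \<alpha> / 2) * D * (1 + \<alpha> / (2 * c) * \<phi> x)"
    by (rule shift_exists)
  then show ?thesis by auto
qed

section \<open>From oscillation to size of the increments\<close>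


text \<open>The increment of a potential over two half-steps is the logarithm of a probability density.\<close>

lemma nn_integral_exp_increment:
  assumes v: "v \<in> borel_measurable N"
    and fin_v: "AE x in M. partition_fun N W v x < \<infinity>"
    and fin_u: "AE y in N. partition_fun M (\<lambda>y x. W x y) (sinkhorn_update N U W v) y < \<infinity>"
  shows "(\<integral>\<^sup>+ y. ennreal (exp (sinkhorn_update M V (\<lambda>y x. W x y) (sinkhorn_update N U W v) y - v y))
    \<partial>gibbs N V) = 1"
proof -
  interpret sw: cost_pair N M V U "\<lambda>y x. W x y" C \<delta> NY NX by (rule swap)
  let ?v' = "sinkhorn_update M V (\<lambda>y x. W x y) (sinkhorn_update N U W v)"
  have [measurable]: "v \<in> borel_measurable N" "?v' \<in> borel_measurable N"
    by (intro v sw.sinkhorn_update_measurable sinkhorn_update_measurable U_meas V_meas)+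
  have "prob_space (density (gibbs N V) (\<lambda>y. ennreal (exp (?v' y - v y))))"
    using bind_gibbs_kernel_mass[OF v fin_v] unfolding bind_gibbs_kernel[OF v fin_v fin_u] .
  from prob_space.emeasure_space_1[OF this] show ?thesis
    by (subst (asm) emeasure_density) (auto simp: space_N sets.top[of N, unfolded space_N])
qed

text \<open>The mean of the increment is minus the relative entropy of \<open>gibbs N V\<close> with respect to the marginal
  produced by the Gibbs kernel of \<open>v\<close>.\<close>

lemma mean_decrease:
  assumes v: "v \<in> borel_measurable N" "integrable (gibbs N V) v"
    and fin_v: "AE x in M. partition_fun N W v x < \<infinity>"
    and fin_u: "AE y in N. partition_fun M (\<lambda>y x. W x y) (sinkhorn_update N U W v) y < \<infinity>"
    and v': "integrable (gibbs N V) (sinkhorn_update M V (\<lambda>y x. W x y) (sinkhorn_update N U W v))"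
  shows "(\<integral>y. sinkhorn_update M V (\<lambda>y x. W x y) (sinkhorn_update N U W v) y \<partial>gibbs N V)
    \<le> (\<integral>y. v y \<partial>gibbs N V)"
proof -
  let ?v' = "sinkhorn_update M V (\<lambda>y x. W x y) (sinkhorn_update N U W v)"
  have "integrable (gibbs N V) (\<lambda>y. ?v' y - v y)" using v v' by simp
  from exp_integral_le_nn_integral_exp[OF prob_V this]
  have "ennreal (exp (\<integral>y. ?v' y - v y \<partial>gibbs N V)) \<le> 1"
    unfolding nn_integral_exp_increment[OF v(1) fin_v fin_u] .
  then show ?thesis using v v' by simp
qed

text \<open>The additive constant \<open>s\<close> is removed from both sides. As the increment \<open>h\<close> is the logarithm of a
  probability density, its mean under \<open>gibbs N V\<close> is at most 0 and its mean under that law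
  reweighted by \<open>exp h\<close> is at least 0; integrating the oscillation bound against these two laws bounds \<open>s\<close> from above
  and from below. The weight is integrable under the reweighted law because the temperedness of both
  potentials gives \<open>h \<le> W\<^sub>U + k + l\<close>.\<close>

lemma increment_normalised:
  fixes mV \<beta> :: real
  defines "\<psi> \<equiv> \<lambda>y. exp (\<delta> * (V y - mV))"
  assumes mV: "\<And>y. mV \<le> V y" and \<beta>: "0 < \<beta>"
  shows "\<exists>K>0. \<forall>v D s. tempered N V (cost_V M U (\<lambda>y x. W x y)) NY k l v \<longrightarrow>
     tempered N V (cost_V M U (\<lambda>y x. W x y)) NY k l
       (sinkhorn_update M V (\<lambda>y x. W x y) (sinkhorn_update N U W v)) \<longrightarrow>
     tempered M U (cost_V N V W) NX k l (sinkhorn_update N U W v) \<longrightarrow> 0 \<le> D \<longrightarrow>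
     (\<forall>y. y \<notin> NY \<longrightarrow> \<bar>sinkhorn_update M V (\<lambda>y x. W x y) (sinkhorn_update N U W v) y - v y - s\<bar>
        \<le> D * (1 + \<beta> * \<psi> y)) \<longrightarrow>
     (\<forall>y. y \<notin> NY \<longrightarrow> \<bar>sinkhorn_update M V (\<lambda>y x. W x y) (sinkhorn_update N U W v) y - v y\<bar> \<le> K * D * \<psi> y)"
proof -
  interpret sw: cost_pair N M V U "\<lambda>y x. W x y" C \<delta> NY NX by (rule swap)
  interpret V: prob_space "gibbs N V" by (rule prob_V)
  note [measurable] = V_meas
  have one: "measure (gibbs N V) (space N) = 1" using V.prob_space by simp
  let ?b = "cost_V M U (\<lambda>y x. W x y)"
  have \<psi>m[measurable]: "\<psi> \<in> borel_measurable N" unfolding \<psi>_def by measurable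
  have \<psi>1: "1 \<le> \<psi> y" for y using mV[of y] \<delta>_pos by (simp add: \<psi>_def)
  have \<psi>_eq: "\<psi> y = exp (- \<delta> * mV) * exp (\<delta> * V y)" for y
    by (simp add: \<psi>_def right_diff_distrib flip: exp_add)
  have \<psi>_int: "integrable (gibbs N V) \<psi>"
    unfolding \<psi>_eq[abs_def] using sw.integrable_exp_U by simp
  have exp_b_int: "integrable (gibbs N V) (\<lambda>y. exp (?b y) * \<psi> y)"
  proof -
    have "(\<integral>\<^sup>+ y. ennreal (exp (?b y + \<delta> * V y)) \<partial>gibbs N V) < \<infinity>"
    proof -
      have "(\<integral>\<^sup>+ y. ennreal (exp (?b y + \<delta> * V y)) \<partial>gibbs N V) = (\<integral>\<^sup>+ y. ennreal (exp (?b y - (1 - \<delta>) * V y)) \<partial>N)"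
        by (subst nn_integral_gibbs)
          (auto intro!: nn_integral_cong simp: algebra_simps simp flip: ennreal_mult' exp_add)
      then show ?thesis using sw.exp_cost_finite by simp
    qed
    then have "integrable (gibbs N V) (\<lambda>y. exp (?b y + \<delta> * V y))"
      by (intro integrableI_nonneg) auto
    then have "integrable (gibbs N V) (\<lambda>y. exp (- \<delta> * mV) * exp (?b y + \<delta> * V y))" by auto
    moreover have "exp (- \<delta> * mV) * exp (?b y + \<delta> * V y) = exp (?b y) * \<psi> y" for y
      unfolding \<psi>_eq exp_add by simp
    ultimately show ?thesis by (simp only: )
  qed
  define J where "J = (\<integral>y. \<psi> y \<partial>gibbs N V) + exp (k + l) * (\<integral>y. exp (?b y) * \<psi> y \<partial>gibbs N V)"
  have J: "(\<integral>y. \<psi> y \<partial>gibbs N V) \<le> J" "exp (k + l) * (\<integral>y. exp (?b y) * \<psi> y \<partial>gibbs N V) \<le> J" "0 \<le> J"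
    unfolding J_def \<psi>_def by (auto intro!: add_nonneg_nonneg mult_nonneg_nonneg integral_nonneg_AE)
  define K where "K = 2 + \<beta> * J + \<beta>"
  have "\<bar>sinkhorn_update M V (\<lambda>y x. W x y) (sinkhorn_update N U W v) y - v y\<bar> \<le> K * D * \<psi> y"
    if v: "tempered N V ?b NY k l v"
      and v': "tempered N V ?b NY k l (sinkhorn_update M V (\<lambda>y x. W x y) (sinkhorn_update N U W v))"
      and u: "tempered M U (cost_V N V W) NX k l (sinkhorn_update N U W v)"
      and D: "0 \<le> D" and h: "\<forall>y. y \<notin> NY \<longrightarrow> \<bar>sinkhorn_update M V (\<lambda>y x. W x y) (sinkhorn_update N U W v) y - v y - s\<bar>
        \<le> D * (1 + \<beta> * \<psi> y)" and y: "y \<notin> NY" for v D s y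
  proof -
    define h where "h y = sinkhorn_update M V (\<lambda>y x. W x y) (sinkhorn_update N U W v) y - v y" for y
    have hs: "\<bar>h y - s\<bar> \<le> D * (1 + \<beta> * \<psi> y)" if "y \<notin> NY" for y using that h by (auto simp: h_def)
    have h_int: "integrable (gibbs N V) h"
      unfolding h_def using sw.integrable_tempered[OF v] sw.integrable_tempered[OF v'] by simp
    have hm[measurable]: "h \<in> borel_measurable N"
      using tempered_measurable[OF v] tempered_measurable[OF v'] by (simp add: h_def[abs_def])
    have fin_v: "AE x in M. partition_fun N W v x < \<infinity>"
      using AE_not_in[OF null_X] by eventually_elim (rule partition_fun_finite[OF v])
    have fin_u: "AE y in N. partition_fun M (\<lambda>y x. W x y) (sinkhorn_update N U W v) y < \<infinity>"
      using AE_not_in[OF null_Y] by eventually_elim (rule sw.partition_fun_finite[OF u])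
    have NY: "AE y in gibbs N V. y \<notin> NY" unfolding AE_gibbs[OF V_meas] by (rule AE_not_in[OF null_Y])
    have "(\<integral>y. h y \<partial>gibbs N V) \<le> 0"
      using mean_decrease[OF tempered_measurable[OF v] sw.integrable_tempered[OF v] fin_v fin_u sw.integrable_tempered[OF v']]
        sw.integrable_tempered[OF v] sw.integrable_tempered[OF v'] by (simp add: h_def)
    moreover have "(\<integral>y. s - D * (1 + \<beta> * \<psi> y) \<partial>gibbs N V) \<le> (\<integral>y. h y \<partial>gibbs N V)"
    proof (rule integral_mono_AE)
      show "AE y in gibbs N V. s - D * (1 + \<beta> * \<psi> y) \<le> h y"
        using NY by eventually_elim (use hs in \<open>force simp: abs_le_iff\<close>)
    qed (use h_int \<psi>_int in auto)
    moreover have "(\<integral>y. s - D * (1 + \<beta> * \<psi> y) \<partial>gibbs N V) = s - D * (1 + \<beta> * (\<integral>y. \<psi> y \<partial>gibbs N V))"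
      using \<psi>_int by (simp add: one)
    ultimately have "s \<le> D * (1 + \<beta> * (\<integral>y. \<psi> y \<partial>gibbs N V))" by linarith
    also have "\<dots> \<le> D * (1 + \<beta> * J)"
      using J D \<beta> by (intro mult_left_mono add_left_mono) auto
    finally have s_le: "s \<le> D * (1 + \<beta> * J)" .
    have mass_nn: "(\<integral>\<^sup>+ y. ennreal (exp (h y)) \<partial>gibbs N V) = 1"
      using nn_integral_exp_increment[OF tempered_measurable[OF v] fin_v fin_u] by (simp add: h_def)
    have e_int: "integrable (gibbs N V) (\<lambda>y. exp (h y))"
      by (rule integrableI_nonneg) (auto simp: mass_nn)
    have mass: "(\<integral>y. exp (h y) \<partial>gibbs N V) = 1"
      using mass_nn by (subst (asm) nn_integral_eq_integral[OF e_int]) auto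
    have tilt: "AE y in gibbs N V. exp (h y) * \<psi> y \<le> exp (k + l) * (exp (?b y) * \<psi> y)"
      using NY
    proof eventually_elim
      case (elim y)
      have "h y \<le> k + l + ?b y" using v v' elim unfolding h_def tempered_def by force
      then have "exp (h y) * \<psi> y \<le> exp (k + l + ?b y) * \<psi> y" using \<psi>1[of y] by (intro mult_right_mono) auto
      then show ?case by (simp add: exp_add)
    qed
    have t_int: "integrable (gibbs N V) (\<lambda>y. exp (h y) * \<psi> y)"
    proof (rule Bochner_Integration.integrable_bound)
      show "integrable (gibbs N V) (\<lambda>y. exp (k + l) * (exp (?b y) * \<psi> y))" using exp_b_int by simp
      show "AE y in gibbs N V. norm (exp (h y) * \<psi> y) \<le> norm (exp (k + l) * (exp (?b y) * \<psi> y))"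
        using tilt by eventually_elim (use \<psi>1 in \<open>simp add: abs_mult abs_of_pos[OF less_le_trans[OF zero_less_one \<psi>1]]\<close>)
    qed auto
    have "(\<integral>y. exp (h y) * \<psi> y \<partial>gibbs N V) \<le> (\<integral>y. exp (k + l) * (exp (?b y) * \<psi> y) \<partial>gibbs N V)"
      using t_int exp_b_int tilt by (intro integral_mono_AE) auto
    then have tJ: "(\<integral>y. exp (h y) * \<psi> y \<partial>gibbs N V) \<le> J" using J by simp
    \<comment> \<open>The mean of \<open>h\<close> under the reweighted law is nonnegative by \<open>t exp t \<ge> exp t - 1\<close>, applied before bounding \<open>h\<close>.\<close>
    have "0 = (\<integral>y. exp (h y) - 1 \<partial>gibbs N V)" using e_int by (simp add: mass one)
    also have "\<dots> \<le> (\<integral>y. exp (h y) * (s + D * (1 + \<beta> * \<psi> y)) \<partial>gibbs N V)"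
    proof (rule integral_mono_AE)
      show "integrable (gibbs N V) (\<lambda>y. exp (h y) * (s + D * (1 + \<beta> * \<psi> y)))"
      proof -
        have "integrable (gibbs N V) (\<lambda>y. (s + D) * exp (h y) + D * \<beta> * (exp (h y) * \<psi> y))"
          using e_int t_int by auto
        then show ?thesis by (simp add: algebra_simps)
      qed
      show "AE y in gibbs N V. exp (h y) - 1 \<le> exp (h y) * (s + D * (1 + \<beta> * \<psi> y))"
        using NY
      proof eventually_elim
        case (elim y)
        have "exp (h y) * (1 - h y) \<le> exp (h y) * exp (- h y)"
          using exp_ge_add_one_self[of "- h y"] by (intro mult_left_mono) auto
        then have "exp (h y) - 1 \<le> exp (h y) * h y" by (simp add: algebra_simps flip: exp_add)
        also have "\<dots> \<le> exp (h y) * (s + D * (1 + \<beta> * \<psi> y))"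
          using hs[OF elim] by (intro mult_left_mono) (auto simp: abs_le_iff)
        finally show ?case .
      qed
    qed (use e_int in auto)
    also have "\<dots> = (\<integral>y. (s + D) * exp (h y) + D * \<beta> * (exp (h y) * \<psi> y) \<partial>gibbs N V)"
      by (intro Bochner_Integration.integral_cong) (auto simp: algebra_simps)
    also have "\<dots> = s + D * (1 + \<beta> * (\<integral>y. exp (h y) * \<psi> y \<partial>gibbs N V))"
      using e_int t_int by (simp add: mass algebra_simps)
    also have "\<dots> \<le> s + D * (1 + \<beta> * J)"
      using tJ D \<beta> by (intro add_left_mono mult_left_mono) auto
    finally have "- s \<le> D * (1 + \<beta> * J)" by linarith
    with s_le have "\<bar>h y\<bar> \<le> D * (1 + \<beta> * J) + D * (1 + \<beta> * \<psi> y)"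
      using hs[OF y] by linarith
    also have "\<dots> \<le> D * (1 + \<beta> * J) * \<psi> y + D * (1 * \<psi> y + \<beta> * \<psi> y)"
    proof (rule add_mono)
      have "0 \<le> D * (1 + \<beta> * J)" using D \<beta> J by auto
      from mult_left_mono[OF \<psi>1[of y] this] show "D * (1 + \<beta> * J) \<le> D * (1 + \<beta> * J) * \<psi> y" by simp
      show "D * (1 + \<beta> * \<psi> y) \<le> D * (1 * \<psi> y + \<beta> * \<psi> y)"
        using D \<psi>1[of y] by (intro mult_left_mono) auto
    qed
    also have "\<dots> = K * D * \<psi> y" by (simp add: K_def algebra_simps)
    finally show ?thesis unfolding h_def .
  qed
  moreover have "0 < K" using \<beta> J by (simp add: K_def add_pos_nonneg)
  ultimately show ?thesis by (intro exI[of _ K] conjI allI impI)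
qed

section \<open>The iteration\<close>


lemma kernels_close:
  "\<exists>e. 0 < e \<and> e \<le> 1 \<and> (\<forall>v x1 x2. adm k l v \<longrightarrow> x1 \<notin> NX \<longrightarrow> x2 \<notin> NX \<longrightarrow> U x1 \<le> r \<longrightarrow> U x2 \<le> r \<longrightarrow>
     tv_dist (gibbs_kernel N W v x1) (gibbs_kernel N W v x2) \<le> 1 - e)"
proof -
  obtain \<alpha> q where \<alpha>: "0 < \<alpha>" and q: "integrable N q" "\<alpha> \<le> (\<integral>y. q y \<partial>N)"
    and minor: "\<And>v x. adm k l v \<Longrightarrow> x \<notin> NX \<Longrightarrow> U x \<le> r \<Longrightarrow> AE y in N. q y \<le> gibbs_density N W v x y"
    using kernel_minorised[of k l r] by blast
  have "tv_dist (gibbs_kernel N W v x1) (gibbs_kernel N W v x2) \<le> 1 - min \<alpha> 1"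
    if adm: "adm k l v" and x1: "x1 \<notin> NX" "U x1 \<le> r" and x2: "x2 \<notin> NX" "U x2 \<le> r" for v x1 x2
  proof -
    have v: "v \<in> borel_measurable N" using adm by (auto simp: admissible_def tempered_def)
    have fin: "partition_fun N W v x1 < \<infinity>" "partition_fun N W v x2 < \<infinity>"
      using adm partition_fun_finite x1 x2 by (auto simp: admissible_def)
    show ?thesis unfolding gibbs_kernel_density[OF v fin(1)] gibbs_kernel_density[OF v fin(2)]
      by (rule tv_dist_le_of_common_part[OF gibbs_density_integral(1)[OF v fin(1)] gibbs_density_nonneg
        gibbs_density_integral(2)[OF v fin(1)] gibbs_density_integral(1)[OF v fin(2)] gibbs_density_nonneg
        gibbs_density_integral(2)[OF v fin(2)] q(1) minor[OF adm x1] minor[OF adm x2]])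
        (use q(2) in auto)
  qed
  then show ?thesis using \<alpha> by (intro exI[of _ "min \<alpha> 1"]) auto
qed

end

text \<open>The initial potential on the second space is 0 in the application, which in general is not
  tempered. The induction therefore starts from its integrability and from finite normalising
  constants.\<close>

locale sinkhorn_iteration = cost_pair +
  fixes u :: "nat \<Rightarrow> 'a \<Rightarrow> real" and v :: "nat \<Rightarrow> 'b \<Rightarrow> real"
  assumes u_eq: "\<And>n. u n = sinkhorn_update N U W (v n)"
    and v_eq: "\<And>n. v (Suc n) = sinkhorn_update M V (\<lambda>y x. W x y) (u n)"
    and u_0: "u 0 = U" and v_0: "v 0 \<in> borel_measurable N" "integrable (gibbs N V) (v 0)"
    and fin_0: "\<And>x. partition_fun N W (v 0) x < \<infinity>"
begin

text \<open>Temperedness and the control of the means have to be propagated together: each lower bound on a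
  potential comes from the means on the other side, and the means decrease only once the potentials are
  integrable.\<close>

lemma potentials_tempered:
  "\<exists>k l. \<forall>n. tempered M U (cost_V N V W) NX k l (u n) \<and>
     tempered N V (cost_V M U (\<lambda>y x. W x y)) NY k l (v (Suc n))"
proof -
  interpret sw: cost_pair N M V U "\<lambda>y x. W x y" C \<delta> NY NX by (rule swap)
  let ?a = "cost_V N V W" and ?b = "cost_V M U (\<lambda>y x. W x y)"
  \<comment> \<open>The lower constant is fixed by the initial mean on the second space; on the first space the
  initial mean of \<open>u - U\<close> is 0.\<close>
  define k where "k = max 0 ((\<integral>y. v 0 y \<partial>gibbs N V) - (\<integral>y. V y \<partial>gibbs N V))"
  obtain L1 where L1: "\<And>k l v. tempered N V ?b NY k l v \<Longrightarrow>
     (\<integral>y. v y \<partial>gibbs N V) - (\<integral>y. V y \<partial>gibbs N V) \<le> k \<Longrightarrow>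
     tempered M U ?a NX k (L1 + k) (sinkhorn_update N U W v)"
    using update_tempered by blast
  obtain L2 where L2: "\<And>k l u. tempered M U ?a NX k l u \<Longrightarrow>
     (\<integral>x. u x \<partial>gibbs M U) - (\<integral>x. U x \<partial>gibbs M U) \<le> k \<Longrightarrow>
     tempered N V ?b NY k (L2 + k) (sinkhorn_update M V (\<lambda>y x. W x y) u)"
    using sw.update_tempered by blast
  define l where "l = max 0 (max (L1 + k) (L2 + k))"
  have weaken: "tempered M' U' a' E k l' w \<Longrightarrow> l' \<le> l \<Longrightarrow> tempered M' U' a' E k l w" for M' U' a' E l' w
    unfolding tempered_def by (meson add_left_mono order_trans)
  note L1' = weaken[OF L1] and L2' = weaken[OF L2]
  define P where "P n \<longleftrightarrow> tempered M U ?a NX k l (u n) \<and> v n \<in> borel_measurable N \<and>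
      integrable (gibbs N V) (v n) \<and> (\<forall>x. x \<notin> NX \<longrightarrow> partition_fun N W (v n) x < \<infinity>) \<and>
      (\<integral>x. u n x \<partial>gibbs M U) \<le> (\<integral>x. U x \<partial>gibbs M U) \<and>
      (\<integral>y. v n y \<partial>gibbs N V) \<le> (\<integral>y. v 0 y \<partial>gibbs N V)" for n
  have step: "P (Suc n) \<and> tempered N V ?b NY k l (v (Suc n))" if Pn: "P n" for n
  proof -
    have u: "tempered M U ?a NX k l (u n)" and vm: "v n \<in> borel_measurable N"
      and vi: "integrable (gibbs N V) (v n)" and fin: "\<And>x. x \<notin> NX \<Longrightarrow> partition_fun N W (v n) x < \<infinity>"
      and mu: "(\<integral>x. u n x \<partial>gibbs M U) \<le> (\<integral>x. U x \<partial>gibbs M U)"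
      and mv: "(\<integral>y. v n y \<partial>gibbs N V) \<le> (\<integral>y. v 0 y \<partial>gibbs N V)"
      using Pn by (auto simp: P_def)
    have finX: "AE x in M. partition_fun N W (v n) x < \<infinity>"
      using AE_not_in[OF null_X] by eventually_elim (rule fin)
    have finY: "AE y in N. partition_fun M (\<lambda>y x. W x y) (u n) y < \<infinity>"
      using AE_not_in[OF null_Y] by eventually_elim (rule sw.partition_fun_finite[OF u])
    have v': "tempered N V ?b NY k l (v (Suc n))"
      unfolding v_eq by (rule L2'[OF u]) (use mu in \<open>auto simp: k_def l_def\<close>)
    note vi' = sw.integrable_tempered[OF v']
    have mv': "(\<integral>y. v (Suc n) y \<partial>gibbs N V) \<le> (\<integral>y. v n y \<partial>gibbs N V)"
      using mean_decrease[OF vm vi finX finY[unfolded u_eq]] vi' by (simp add: v_eq u_eq)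
    note fin' = partition_fun_finite[OF v']
    have finX': "AE x in M. partition_fun N W (v (Suc n)) x < \<infinity>"
      using AE_not_in[OF null_X] by eventually_elim (rule fin')
    have u': "tempered M U ?a NX k l (u (Suc n))"
      unfolding u_eq[of "Suc n"] by (rule L1'[OF v']) (use mv mv' in \<open>auto simp: k_def l_def\<close>)
    have mu': "(\<integral>x. u (Suc n) x \<partial>gibbs M U) \<le> (\<integral>x. u n x \<partial>gibbs M U)"
      using sw.mean_decrease[OF tempered_measurable[OF u] integrable_tempered[OF u] finY
        finX'[unfolded v_eq]] integrable_tempered[OF u']
      by (simp add: v_eq u_eq[of "Suc n"])
    show ?thesis
      unfolding P_def using u' v' tempered_measurable[OF v'] vi' fin' mu' mu mv' mv by auto
  qed
  have "P 0"
    unfolding P_def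
  proof (intro conjI allI impI v_0 fin_0)
    show "tempered M U ?a NX k l (u 0)"
      unfolding tempered_def
    proof (intro conjI allI impI)
      show "u 0 \<in> borel_measurable M" by (simp add: u_0 U_meas)
      fix x
      have "U x - ?a x - k \<le> sinkhorn_update N U W (v 0) x"
        using update_lower[OF v_0 fin_0, of x] by (simp add: k_def)
      then show "U x - ?a x - k \<le> u 0 x" by (simp add: u_eq)
      show "u 0 x \<le> U x + l" by (simp add: u_0 l_def)
    qed
  qed (simp_all add: u_0)
  then have "P n" for n by (induction n) (use step in auto)
  then show ?thesis using step unfolding P_def by blast
qed

text \<open>Each half-step multiplies the weighted oscillation by \<open>\<gamma>\<close>, provided that both half-steps use the same
  constants \<open>c\<close> and \<open>\<alpha>\<close>: a larger drift constant and a smaller common mass are always allowed. The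
  bound starts at \<open>n = 1\<close>, since the initial potential on the second space is not tempered.\<close>

lemma increments_decay:
  fixes mU mV
  defines "\<phi> \<equiv> \<lambda>x. exp (\<delta> * (U x - mU))" and "\<psi> \<equiv> \<lambda>y. exp (\<delta> * (V y - mV))"
  assumes mU: "\<And>x. mU \<le> U x" and mV: "\<And>y. mV \<le> V y"
  shows "\<exists>\<rho> K. 0 < \<rho> \<and> \<rho> < 1 \<and> 0 < K \<and> (\<forall>n\<ge>1.
     (\<forall>y. y \<notin> NY \<longrightarrow> \<bar>v (Suc n) y - v n y\<bar> \<le> K * \<rho> ^ (2 * n) * \<psi> y) \<and>
     (\<forall>x. x \<notin> NX \<longrightarrow> \<bar>u (Suc n) x - u n x\<bar> \<le> K * \<rho> ^ (2 * n) * \<phi> x))"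
proof -
  interpret sw: cost_pair N M V U "\<lambda>y x. W x y" C \<delta> NY NX by (rule swap)
  let ?a = "cost_V N V W" and ?b = "cost_V M U (\<lambda>y x. W x y)"
  obtain k l where temp: "\<And>n. tempered M U ?a NX k l (u n)" "\<And>n. tempered N V ?b NY k l (v (Suc n))"
    using potentials_tempered by blast
  have temp_v: "tempered N V ?b NY k l (v n)" if "1 \<le> n" for n
    using temp(2)[of "n - 1"] that by simp
  have admY: "adm k l (v n)" if "1 \<le> n" for n
    using temp_v[OF that] temp(1)[of n] by (simp add: admissible_def u_eq)
  have admX: "sw.adm k l (u n)" for n
    using temp(1)[of n] temp(2)[of n] by (simp add: admissible_def v_eq)
  obtain c1 where c1: "0 < c1" "\<And>v x. adm k l v \<Longrightarrow> x \<notin> NX \<Longrightarrow>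
      kapp (gibbs_kernel N W v) \<psi> x \<le> ennreal (1/2 * \<phi> x + c1)"
    using kernel_drift[of "1/2" k l mV mU] unfolding \<phi>_def \<psi>_def by auto
  obtain c2 where c2: "0 < c2" "\<And>u y. sw.adm k l u \<Longrightarrow> y \<notin> NY \<Longrightarrow>
      kapp (gibbs_kernel M (\<lambda>y x. W x y) u) \<phi> y \<le> ennreal (1/2 * \<psi> y + c2)"
    using sw.kernel_drift[of "1/2" k l mU mV] unfolding \<phi>_def \<psi>_def by auto
  define c where "c = max c1 c2"
  have c: "0 < c" using c1 by (simp add: c_def)
  have drift1: "kapp (gibbs_kernel N W v) \<psi> x \<le> ennreal (\<phi> x / 2 + c)" if "adm k l v" "x \<notin> NX" for v x
    using c1(2)[OF that] by (rule order_trans) (simp add: c_def ennreal_leI)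
  have drift2: "kapp (gibbs_kernel M (\<lambda>y x. W x y) u) \<phi> y \<le> ennreal (\<psi> y / 2 + c)" if "sw.adm k l u" "y \<notin> NY" for u y
    using c2(2)[OF that] by (rule order_trans) (simp add: c_def ennreal_leI)
  \<comment> \<open>Sub-level sets of \<open>\<phi>\<close> are sub-level sets of \<open>U\<close>, and similarly for \<open>\<psi>\<close> and \<open>V\<close>.\<close>
  have sub: "t \<le> m + ln (16 * c) / \<delta>" if "exp (\<delta> * (t - m)) \<le> 16 * c" for t m
  proof -
    have "\<delta> * (t - m) \<le> ln (16 * c)" using that c by (subst ln_ge_iff) auto
    then show ?thesis using \<delta>_pos by (simp add: field_simps)
  qed
  obtain \<alpha>1 q1 where q1: "0 < \<alpha>1" "integrable N q1" "\<And>y. 0 \<le> q1 y" "\<alpha>1 \<le> (\<integral>y. q1 y \<partial>N)"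
    "\<And>v x. adm k l v \<Longrightarrow> x \<notin> NX \<Longrightarrow> U x \<le> mU + ln (16 * c) / \<delta> \<Longrightarrow> AE y in N. q1 y \<le> gibbs_density N W v x y"
    using kernel_minorised[of k l "mU + ln (16 * c) / \<delta>"] by blast
  obtain \<alpha>2 q2 where q2: "0 < \<alpha>2" "integrable M q2" "\<And>x. 0 \<le> q2 x" "\<alpha>2 \<le> (\<integral>x. q2 x \<partial>M)"
    "\<And>u y. sw.adm k l u \<Longrightarrow> y \<notin> NY \<Longrightarrow> V y \<le> mV + ln (16 * c) / \<delta> \<Longrightarrow>
       AE x in M. q2 x \<le> gibbs_density M (\<lambda>y x. W x y) u y x"
    using sw.kernel_minorised[of k l "mV + ln (16 * c) / \<delta>"] by blast
  define \<alpha> where "\<alpha> = min \<alpha>1 \<alpha>2"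
  have \<alpha>: "0 < \<alpha>" "\<alpha> \<le> (\<integral>y. q1 y \<partial>N)" "\<alpha> \<le> (\<integral>x. q2 x \<partial>M)" using q1 q2 by (auto simp: \<alpha>_def)
  define \<beta> where "\<beta> = \<alpha> / (2 * c)"
  define \<gamma> where "\<gamma> = max (3/4) (1 - \<alpha> / 2)"
  have \<beta>: "0 < \<beta>" and \<gamma>: "0 < \<gamma>" "\<gamma> < 1" using \<alpha> c by (auto simp: \<beta>_def \<gamma>_def)
  have stepX: "\<exists>s'. \<forall>x. x \<notin> NX \<longrightarrow> \<bar>u (Suc n) x - u n x - s'\<bar> \<le> \<gamma> * D * (1 + \<beta> * \<phi> x)"
    if n: "1 \<le> n" and D: "0 \<le> D" and h: "\<And>y. y \<notin> NY \<Longrightarrow> \<bar>v (Suc n) y - v n y - s\<bar> \<le> D * (1 + \<beta> * \<psi> y)" for n D s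
  proof -
    have adm2: "adm k l (v (Suc n))" by (rule admY) simp
    show ?thesis unfolding u_eq \<gamma>_def \<beta>_def \<phi>_def
      by (rule update_contracts[OF drift1[unfolded \<phi>_def \<psi>_def] q1(2,3) \<alpha>(2) _ c \<alpha>(1) D admY[OF n] adm2
        h[unfolded \<beta>_def \<psi>_def]]) (use q1(5) sub in auto)
  qed
  have stepY: "\<exists>s'. \<forall>y. y \<notin> NY \<longrightarrow> \<bar>v (Suc (Suc n)) y - v (Suc n) y - s'\<bar> \<le> \<gamma> * D * (1 + \<beta> * \<psi> y)"
    if D: "0 \<le> D" and h: "\<And>x. x \<notin> NX \<Longrightarrow> \<bar>u (Suc n) x - u n x - s\<bar> \<le> D * (1 + \<beta> * \<phi> x)" for n D s
    unfolding v_eq \<gamma>_def \<beta>_def \<psi>_def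
    by (rule sw.update_contracts[OF drift2[unfolded \<phi>_def \<psi>_def] q2(2,3) \<alpha>(3) _ c \<alpha>(1) D admX admX
        h[unfolded \<beta>_def \<phi>_def]]) (use q2(5) sub in auto)
  have \<psi>1: "1 \<le> \<psi> y" for y using mV[of y] \<delta>_pos by (simp add: \<psi>_def)
  obtain b0 where b0: "\<And>y. ?b y \<le> \<delta> * V y + b0" using sw.cost_upper by blast
  \<comment> \<open>Division by \<open>\<gamma>\<^sup>2\<close> because the induction starts at \<open>n = 1\<close>, where \<open>\<gamma> ^ (2 * n) = \<gamma>\<^sup>2\<close>.\<close>
  define D0 where "D0 = (\<bar>k + l + \<delta> * mV + b0\<bar> + 1 / \<beta>) / \<gamma>\<^sup>2"
  have D0: "0 \<le> D0" using \<beta> \<gamma> by (simp add: D0_def)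
  have start: "\<bar>v (Suc 1) y - v 1 y - 0\<bar> \<le> D0 * \<gamma> ^ (2 * 1) * (1 + \<beta> * \<psi> y)" if y: "y \<notin> NY" for y
  proof -
    have "\<bar>v (Suc 1) y - v 1 y\<bar> \<le> ?b y + k + l"
      using temp(2)[of 0] temp(2)[of 1] y unfolding tempered_def by (force simp: abs_le_iff)
    also have "\<dots> \<le> (k + l + \<delta> * mV + b0) + \<delta> * (V y - mV)" using b0[of y] by (simp add: algebra_simps)
    also have "\<dots> \<le> \<bar>k + l + \<delta> * mV + b0\<bar> + \<psi> y"
      using exp_ge_add_one_self[of "\<delta> * (V y - mV)"] unfolding \<psi>_def by linarith
    also have "\<dots> \<le> (\<bar>k + l + \<delta> * mV + b0\<bar> + 1 / \<beta>) * (1 + \<beta> * \<psi> y)"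
    proof -
      have "0 \<le> \<bar>k + l + \<delta> * mV + b0\<bar> * (\<beta> * \<psi> y)" using \<beta> \<psi>1[of y] by simp
      then show ?thesis using \<beta> by (simp add: distrib_left distrib_right add_nonneg_nonneg)
    qed
    also have "\<dots> = D0 * \<gamma> ^ (2 * 1) * (1 + \<beta> * \<psi> y)" using \<gamma> by (simp add: D0_def)
    finally show ?thesis by simp
  qed
  have osc_v: "\<exists>s. \<forall>y. y \<notin> NY \<longrightarrow> \<bar>v (Suc n) y - v n y - s\<bar> \<le> D0 * \<gamma> ^ (2 * n) * (1 + \<beta> * \<psi> y)"
    if "1 \<le> n" for n using that
  proof (induction n rule: dec_induct)
    case base
    show ?case using start by (intro exI[of _ 0]) blast
  next
    case (step n)
    have D: "0 \<le> D0 * \<gamma> ^ (2 * n)" using D0 \<gamma> by simp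
    obtain s where "\<And>y. y \<notin> NY \<Longrightarrow> \<bar>v (Suc n) y - v n y - s\<bar> \<le> D0 * \<gamma> ^ (2 * n) * (1 + \<beta> * \<psi> y)"
      using step.IH by blast
    from stepX[OF step.hyps(1) D this] obtain s'
      where s': "\<And>x. x \<notin> NX \<Longrightarrow> \<bar>u (Suc n) x - u n x - s'\<bar> \<le> \<gamma> * (D0 * \<gamma> ^ (2 * n)) * (1 + \<beta> * \<phi> x)" by blast
    have "0 \<le> \<gamma> * (D0 * \<gamma> ^ (2 * n))" using D \<gamma> by simp
    from stepY[OF this s'] show ?case by (simp add: mult_ac)
  qed
  have osc_u: "\<exists>s. \<forall>x. x \<notin> NX \<longrightarrow> \<bar>u (Suc n) x - u n x - s\<bar> \<le> D0 * \<gamma> ^ (2 * n) * (1 + \<beta> * \<phi> x)"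
    if n: "1 \<le> n" for n
  proof -
    have D: "0 \<le> D0 * \<gamma> ^ (2 * n)" using D0 \<gamma> by simp
    obtain s where "\<And>y. y \<notin> NY \<Longrightarrow> \<bar>v (Suc n) y - v n y - s\<bar> \<le> D0 * \<gamma> ^ (2 * n) * (1 + \<beta> * \<psi> y)"
      using osc_v[OF n] by blast
    from stepX[OF n D this] obtain s'
      where s': "\<And>x. x \<notin> NX \<Longrightarrow> \<bar>u (Suc n) x - u n x - s'\<bar> \<le> \<gamma> * (D0 * \<gamma> ^ (2 * n)) * (1 + \<beta> * \<phi> x)" by blast
    have "\<gamma> * (D0 * \<gamma> ^ (2 * n)) * (1 + \<beta> * \<phi> x) \<le> 1 * (D0 * \<gamma> ^ (2 * n)) * (1 + \<beta> * \<phi> x)" for x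
      using D \<gamma> \<beta> by (intro mult_right_mono) (auto simp: \<phi>_def)
    with s' show ?thesis by (intro exI[of _ s']) (force intro: order_trans)
  qed
  obtain K1 where K1: "0 < K1" "\<And>v D s. tempered N V ?b NY k l v \<Longrightarrow>
     tempered N V ?b NY k l (sinkhorn_update M V (\<lambda>y x. W x y) (sinkhorn_update N U W v)) \<Longrightarrow>
     tempered M U ?a NX k l (sinkhorn_update N U W v) \<Longrightarrow> 0 \<le> D \<Longrightarrow>
     (\<forall>y. y \<notin> NY \<longrightarrow> \<bar>sinkhorn_update M V (\<lambda>y x. W x y) (sinkhorn_update N U W v) y - v y - s\<bar>
        \<le> D * (1 + \<beta> * \<psi> y)) \<Longrightarrow>
     (\<forall>y. y \<notin> NY \<longrightarrow> \<bar>sinkhorn_update M V (\<lambda>y x. W x y) (sinkhorn_update N U W v) y - v y\<bar> \<le> K1 * D * \<psi> y)"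
    using increment_normalised[OF mV \<beta>, of k l] unfolding \<psi>_def by blast
  obtain K2 where K2: "0 < K2" "\<And>u D s. tempered M U ?a NX k l u \<Longrightarrow>
     tempered M U ?a NX k l (sinkhorn_update N U W (sinkhorn_update M V (\<lambda>y x. W x y) u)) \<Longrightarrow>
     tempered N V ?b NY k l (sinkhorn_update M V (\<lambda>y x. W x y) u) \<Longrightarrow> 0 \<le> D \<Longrightarrow>
     (\<forall>x. x \<notin> NX \<longrightarrow> \<bar>sinkhorn_update N U W (sinkhorn_update M V (\<lambda>y x. W x y) u) x - u x - s\<bar>
        \<le> D * (1 + \<beta> * \<phi> x)) \<Longrightarrow>
     (\<forall>x. x \<notin> NX \<longrightarrow> \<bar>sinkhorn_update N U W (sinkhorn_update M V (\<lambda>y x. W x y) u) x - u x\<bar> \<le> K2 * D * \<phi> x)"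
    using sw.increment_normalised[OF mU \<beta>, of k l] unfolding \<phi>_def by blast
  define K where "K = max K1 K2 * (D0 + 1)"
  have K: "0 < K" using K1 K2 D0 by (simp add: K_def less_max_iff_disj)
  have mono: "Ki * (D0 * \<gamma> ^ (2 * n)) * w \<le> K * \<gamma> ^ (2 * n) * w" if "Ki \<le> max K1 K2" "0 < Ki" "0 \<le> w" for Ki w n
  proof -
    have "Ki * D0 \<le> K" unfolding K_def using that D0 by (intro mult_mono) auto
    then have "Ki * D0 * (\<gamma> ^ (2 * n) * w) \<le> K * (\<gamma> ^ (2 * n) * w)" using \<gamma> that by (intro mult_right_mono) auto
    then show ?thesis by (simp add: mult_ac)
  qed
  have "\<bar>v (Suc n) y - v n y\<bar> \<le> K * \<gamma> ^ (2 * n) * \<psi> y" if n: "1 \<le> n" and y: "y \<notin> NY" for n y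
  proof -
    have D: "0 \<le> D0 * \<gamma> ^ (2 * n)" using D0 \<gamma> by simp
    obtain s where s: "\<forall>y. y \<notin> NY \<longrightarrow> \<bar>v (Suc n) y - v n y - s\<bar> \<le> D0 * \<gamma> ^ (2 * n) * (1 + \<beta> * \<psi> y)"
      using osc_v[OF n] by blast
    have "\<bar>v (Suc n) y - v n y\<bar> \<le> K1 * (D0 * \<gamma> ^ (2 * n)) * \<psi> y"
      using K1(2)[OF temp_v[OF n] temp(2)[of n, unfolded v_eq u_eq] temp(1)[of n, unfolded u_eq] D s[unfolded v_eq u_eq]] y
      by (simp add: v_eq u_eq)
    also have "\<dots> \<le> K * \<gamma> ^ (2 * n) * \<psi> y" using K1(1) \<psi>1[of y] by (intro mono) auto
    finally show ?thesis .
  qed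
  moreover have "\<bar>u (Suc n) x - u n x\<bar> \<le> K * \<gamma> ^ (2 * n) * \<phi> x" if n: "1 \<le> n" and x: "x \<notin> NX" for n x
  proof -
    have D: "0 \<le> D0 * \<gamma> ^ (2 * n)" using D0 \<gamma> by simp
    have u_suc: "u (Suc n) = sinkhorn_update N U W (sinkhorn_update M V (\<lambda>y x. W x y) (u n))"
      by (simp add: u_eq[of "Suc n"] v_eq)
    obtain s where s: "\<forall>x. x \<notin> NX \<longrightarrow> \<bar>u (Suc n) x - u n x - s\<bar> \<le> D0 * \<gamma> ^ (2 * n) * (1 + \<beta> * \<phi> x)"
      using osc_u[OF n] by blast
    have "\<bar>u (Suc n) x - u n x\<bar> \<le> K2 * (D0 * \<gamma> ^ (2 * n)) * \<phi> x"
      using K2(2)[OF temp(1)[of n] temp(1)[of "Suc n", unfolded u_suc] temp(2)[of n, unfolded v_eq] D s[unfolded u_suc]] x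
      by (simp add: u_suc)
    also have "\<dots> \<le> K * \<gamma> ^ (2 * n) * \<phi> x" using K2(1) by (intro mono) (auto simp: \<phi>_def)
    finally show ?thesis .
  qed
  ultimately show ?thesis using \<gamma> K by (intro exI[of _ \<gamma>] exI[of _ K]) auto
qed

lemma potentials_admissible:
  "\<exists>k l. \<forall>n\<ge>1. admissible M N U V W NX NY k l (v n) \<and> admissible N M V U (\<lambda>y x. W x y) NY NX k l (u n)"
proof -
  obtain k l where temp: "\<And>n. tempered M U (cost_V N V W) NX k l (u n)"
    "\<And>n. tempered N V (cost_V M U (\<lambda>y x. W x y)) NY k l (v (Suc n))"
    using potentials_tempered by blast
  have "tempered N V (cost_V M U (\<lambda>y x. W x y)) NY k l (v n)" if "1 \<le> n" for n
    using temp(2)[of "n - 1"] that by simp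
  then show ?thesis
    using temp unfolding admissible_def u_eq[symmetric] v_eq[symmetric]
    by (intro exI[of _ k] exI[of _ l]) auto
qed

lemma potentials_measurable: "u n \<in> borel_measurable M" "v n \<in> borel_measurable N"
proof -
  obtain k l where temp: "\<And>n. tempered M U (cost_V N V W) NX k l (u n)"
    "\<And>n. tempered N V (cost_V M U (\<lambda>y x. W x y)) NY k l (v (Suc n))"
    using potentials_tempered by blast
  show "u n \<in> borel_measurable M" using temp(1)[of n] by (simp add: tempered_def)
  show "v n \<in> borel_measurable N"
  proof (cases n)
    case (Suc m)
    then show ?thesis using temp(2)[of m] by (simp add: tempered_def)
  qed (use v_0 in simp)
qed

lemma condition_D:
  assumes mU: "\<And>x. mU \<le> U x" and mV: "\<And>y. mV \<le> V y"
  shows "cond_D (\<lambda>n. gibbs_kernel N W (v n)) (\<lambda>n. gibbs_kernel M (\<lambda>y x. W x y) (u n))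
    (\<lambda>x. exp (\<delta> * (U x - mU))) (\<lambda>y. exp (\<delta> * (V y - mV))) 1 NX NY"
proof -
  interpret sw: cost_pair N M V U "\<lambda>y x. W x y" C \<delta> NY NX by (rule swap)
  let ?\<phi> = "\<lambda>x. exp (\<delta> * (U x - mU))" and ?\<psi> = "\<lambda>y. exp (\<delta> * (V y - mV))"
  obtain k l where adm: "\<And>n. 1 \<le> n \<Longrightarrow> adm k l (v n)" "\<And>n. 1 \<le> n \<Longrightarrow> sw.adm k l (u n)"
    using potentials_admissible by blast
  obtain c1 where c1: "0 < c1" "\<And>v x. adm k l v \<Longrightarrow> x \<notin> NX \<Longrightarrow>
      kapp (gibbs_kernel N W v) ?\<psi> x \<le> ennreal (1/2 * ?\<phi> x + c1)"
    using kernel_drift[of "1/2" k l mV mU] by auto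
  obtain c2 where c2: "0 < c2" "\<And>u y. sw.adm k l u \<Longrightarrow> y \<notin> NY \<Longrightarrow>
      kapp (gibbs_kernel M (\<lambda>y x. W x y) u) ?\<phi> y \<le> ennreal (1/2 * ?\<psi> y + c2)"
    using sw.kernel_drift[of "1/2" k l mU mV] by auto
  have d1: "kapp (gibbs_kernel N W (v n)) ?\<psi> x \<le> ennreal (1/2 * ?\<phi> x + max c1 c2)" if "1 \<le> n" "x \<notin> NX" for n x
    using c1(2)[OF adm(1)[OF that(1)] that(2)] by (rule order_trans) (simp add: ennreal_leI)
  have d2: "kapp (gibbs_kernel M (\<lambda>y x. W x y) (u n)) ?\<phi> y \<le> ennreal (1/2 * ?\<psi> y + max c1 c2)"
    if "1 \<le> n" "y \<notin> NY" for n y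
    using c2(2)[OF adm(2)[OF that(1)] that(2)] by (rule order_trans) (simp add: ennreal_leI)
  have sub: "t \<le> m + ln r / \<delta>" if "exp (\<delta> * (t - m)) \<le> r" for t m r
  proof -
    have "0 < r" using that by (rule less_le_trans[rotated]) simp
    then have "\<delta> * (t - m) \<le> ln r" using that by (subst ln_ge_iff) auto
    then show ?thesis using \<delta>_pos by (simp add: field_simps)
  qed
  define mixing where "mixing r e \<longleftrightarrow> (\<forall>n\<ge>1.
      (\<forall>x1\<in>{x. ?\<phi> x \<le> r} - NX. \<forall>x2\<in>{x. ?\<phi> x \<le> r} - NX.
         tv_dist (gibbs_kernel N W (v n) x1) (gibbs_kernel N W (v n) x2) \<le> 1 - e) \<and>
      (\<forall>y1\<in>{y. ?\<psi> y \<le> r} - NY. \<forall>y2\<in>{y. ?\<psi> y \<le> r} - NY.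
         tv_dist (gibbs_kernel M (\<lambda>y x. W x y) (u n) y1) (gibbs_kernel M (\<lambda>y x. W x y) (u n) y2) \<le> 1 - e))" for r e
  have "\<exists>e. 0 < e \<and> e \<le> 1 \<and> mixing r e" for r
  proof -
    obtain e1 where e1: "0 < e1" "e1 \<le> 1" "\<And>v x1 x2. adm k l v \<Longrightarrow> x1 \<notin> NX \<Longrightarrow> x2 \<notin> NX \<Longrightarrow>
        U x1 \<le> mU + ln r / \<delta> \<Longrightarrow> U x2 \<le> mU + ln r / \<delta> \<Longrightarrow>
        tv_dist (gibbs_kernel N W v x1) (gibbs_kernel N W v x2) \<le> 1 - e1"
      using kernels_close[of k l "mU + ln r / \<delta>"] by blast
    obtain e2 where e2: "0 < e2" "e2 \<le> 1" "\<And>u y1 y2. sw.adm k l u \<Longrightarrow> y1 \<notin> NY \<Longrightarrow> y2 \<notin> NY \<Longrightarrow>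
        V y1 \<le> mV + ln r / \<delta> \<Longrightarrow> V y2 \<le> mV + ln r / \<delta> \<Longrightarrow>
        tv_dist (gibbs_kernel M (\<lambda>y x. W x y) u y1) (gibbs_kernel M (\<lambda>y x. W x y) u y2) \<le> 1 - e2"
      using sw.kernels_close[of k l "mV + ln r / \<delta>"] by blast
    show ?thesis unfolding mixing_def
    proof (intro exI[of _ "min e1 e2"] conjI allI impI ballI)
      fix n x1 x2 assume "1 \<le> (n::nat)" "x1 \<in> {x. ?\<phi> x \<le> r} - NX" "x2 \<in> {x. ?\<phi> x \<le> r} - NX"
      then show "tv_dist (gibbs_kernel N W (v n) x1) (gibbs_kernel N W (v n) x2) \<le> 1 - min e1 e2"
        using e1(3)[OF adm(1), of n x1 x2] sub[of "U x1" mU r] sub[of "U x2" mU r] by auto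
    next
      fix n y1 y2 assume "1 \<le> (n::nat)" "y1 \<in> {y. ?\<psi> y \<le> r} - NY" "y2 \<in> {y. ?\<psi> y \<le> r} - NY"
      then show "tv_dist (gibbs_kernel M (\<lambda>y x. W x y) (u n) y1) (gibbs_kernel M (\<lambda>y x. W x y) (u n) y2)
          \<le> 1 - min e1 e2"
        using e2(3)[OF adm(2), of n y1 y2] sub[of "V y1" mV r] sub[of "V y2" mV r] by auto
    qed (use e1 e2 in auto)
  qed
  then have "\<forall>r. \<exists>e. 0 < e \<and> e \<le> 1 \<and> mixing r e" by (rule allI)
  from choice[OF this] obtain e where e: "\<And>r. 0 < e r \<and> e r \<le> 1 \<and> mixing r (e r)" by blast
  show ?thesis unfolding cond_D_def
  proof (intro conjI)
    show "\<forall>x. 1 \<le> ?\<phi> x" "\<forall>y. 1 \<le> ?\<psi> y" using mU mV \<delta>_pos by auto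
    show "\<exists>\<epsilon> c. 0 < \<epsilon> \<and> \<epsilon> < 1 \<and> 0 < c \<and>
        (\<forall>n\<ge>1. (\<forall>x. x \<notin> NX \<longrightarrow> kapp (gibbs_kernel N W (v n)) ?\<psi> x \<le> ennreal (\<epsilon> * ?\<phi> x + c)) \<and>
          (\<forall>y. y \<notin> NY \<longrightarrow> kapp (gibbs_kernel M (\<lambda>y x. W x y) (u n)) ?\<phi> y \<le> ennreal (\<epsilon> * ?\<psi> y + c)))"
      using c1(1) d1 d2 by (intro exI[of _ "1/2"] exI[of _ "max c1 c2"]) auto
    show "\<exists>r0 (e :: real \<Rightarrow> real). 1 \<le> r0 \<and> (\<forall>r\<ge>r0. 0 < e r \<and> e r \<le> 1) \<and> (\<forall>r\<ge>r0. \<forall>n\<ge>1.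
      (\<forall>x1\<in>{x. ?\<phi> x \<le> r} - NX. \<forall>x2\<in>{x. ?\<phi> x \<le> r} - NX.
         tv_dist (gibbs_kernel N W (v n) x1) (gibbs_kernel N W (v n) x2) \<le> 1 - e r) \<and>
      (\<forall>y1\<in>{y. ?\<psi> y \<le> r} - NY. \<forall>y2\<in>{y. ?\<psi> y \<le> r} - NY.
         tv_dist (gibbs_kernel M (\<lambda>y x. W x y) (u n) y1) (gibbs_kernel M (\<lambda>y x. W x y) (u n) y2) \<le> 1 - e r))"
    proof (intro exI[of _ 1] exI[of _ e] conjI allI impI)
      show "0 < e r" "e r \<le> 1" for r using e[of r] by blast+
    qed (use e in \<open>auto simp: mixing_def\<close>)
  qed
qed

lemma marginals:
  assumes "1 \<le> n"
  shows "Giry_Monad.bind (gibbs M U) (gibbs_kernel N W (v n))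
      = density (gibbs N V) (\<lambda>y. ennreal (exp (v (Suc n) y - v n y)))"
    and "Giry_Monad.bind (gibbs N V) (gibbs_kernel M (\<lambda>y x. W x y) (u n))
      = density (gibbs M U) (\<lambda>x. ennreal (exp (u (Suc n) x - u n x)))"
proof -
  interpret sw: cost_pair N M V U "\<lambda>y x. W x y" C \<delta> NY NX by (rule swap)
  obtain k l where adm: "\<And>n. 1 \<le> n \<Longrightarrow> adm k l (v n)" "\<And>n. 1 \<le> n \<Longrightarrow> sw.adm k l (u n)"
    using potentials_admissible by blast
  have finX: "AE x in M. partition_fun N W (v n) x < \<infinity>" if "1 \<le> n" for n
    using AE_not_in[OF null_X]
    by eventually_elim (use adm(1)[OF that] partition_fun_finite in \<open>auto simp: admissible_def\<close>)
  have finY: "AE y in N. partition_fun M (\<lambda>y x. W x y) (u n) y < \<infinity>"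
    using AE_not_in[OF null_Y]
    by eventually_elim (use adm(2)[OF assms] sw.partition_fun_finite in \<open>auto simp: admissible_def\<close>)
  show "Giry_Monad.bind (gibbs M U) (gibbs_kernel N W (v n))
      = density (gibbs N V) (\<lambda>y. ennreal (exp (v (Suc n) y - v n y)))"
    using bind_gibbs_kernel[OF potentials_measurable(2) finX[OF assms] finY[unfolded u_eq]]
    by (simp add: v_eq u_eq)
  have "AE x in M. partition_fun N W (v (Suc n)) x < \<infinity>" by (rule finX) simp
  from sw.bind_gibbs_kernel[OF potentials_measurable(1) finY this[unfolded v_eq]]
  show "Giry_Monad.bind (gibbs N V) (gibbs_kernel M (\<lambda>y x. W x y) (u n))
      = density (gibbs M U) (\<lambda>x. ennreal (exp (u (Suc n) x - u n x)))"
    by (simp add: v_eq u_eq[of "Suc n"])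
qed

end

section \<open>Topological input and the original notation\<close>

lemma eln_measurable [measurable]: "eln \<in> borel_measurable borel"
  unfolding eln_def[abs_def] by measurable

text \<open>The Radon-Nikodym derivative is only determined almost everywhere, and the essential supremum does
  not see the difference.\<close>

lemma wnorm_log_density_le:
  fixes f w :: "'a \<Rightarrow> real"
  assumes "sigma_finite_measure M" and P: "P = density M (\<lambda>x. ennreal (exp (f x)))"
    and f[measurable]: "f \<in> borel_measurable M" and w[measurable]: "w \<in> borel_measurable M"
    and w_pos: "\<And>x. 0 < w x" and bound: "AE x in M. \<bar>f x\<bar> \<le> B * w x"
  shows "absolutely_continuous M P" and "wnorm M w (log_density M P) \<le> ereal B"
proof -
  interpret sigma_finite_measure M by fact
  show "absolutely_continuous M P" unfolding P by (rule absolutely_continuousI_density) simp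
  have rn: "AE x in M. ennreal (exp (f x)) = RN_deriv M P x"
    by (rule RN_deriv_unique[OF _ P[symmetric]]) simp
  show "wnorm M w (log_density M P) \<le> ereal B"
    unfolding wnorm_def
  proof (rule esssup_I)
    show "(\<lambda>x. \<bar>log_density M P x\<bar> / ereal (w x)) \<in> borel_measurable M"
      unfolding log_density_def[abs_def] by measurable
    show "AE x in M. \<bar>log_density M P x\<bar> / ereal (w x) \<le> ereal B"
      using rn bound
    proof eventually_elim
      case (elim x)
      have "log_density M P x = ereal (f x)" by (simp add: log_density_def eln_def flip: elim(1))
      then have "\<bar>log_density M P x\<bar> / ereal (w x) = ereal (\<bar>f x\<bar> / w x)" using w_pos[of x] by simp
      then show ?case using elim(2) w_pos[of x] by (simp add: pos_divide_le_eq)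
    qed
  qed
qed

lemma bdd_below_of_compact_sublevels:
  assumes "locally_bounded f" "compact_sublevels f"
  shows "bdd_below (range f)"
proof -
  let ?x0 = "undefined :: 'a"
  have "bounded (f ` {x. f x \<le> f ?x0})" using assms by (simp add: locally_bounded_def compact_sublevels_def)
  then obtain B where B: "\<And>x. f x \<le> f ?x0 \<Longrightarrow> \<bar>f x\<bar> \<le> B" by (auto simp: bounded_iff)
  have "- B \<le> f x" for x
  proof (cases "f x \<le> f ?x0")
    case True
    then show ?thesis using B[of x] by simp
  next
    case False
    then show ?thesis using B[of ?x0] by simp
  qed
  then show ?thesis by (rule bdd_belowI2)
qed

text \<open>Outside the compact set where \<open>\<delta> F - a \<le> - ln \<epsilon>\<close> the first summand suffices; on it everything is
  bounded.\<close>

lemma exp_growth_of_compact_sublevels: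
  fixes a F :: "'a::topological_space \<Rightarrow> real"
  assumes F: "locally_bounded F" and G: "locally_bounded (\<lambda>x. \<delta> * F x - a x)" "compact_sublevels (\<lambda>x. \<delta> * F x - a x)"
    and \<epsilon>: "0 < \<epsilon>"
  shows "\<exists>c. \<forall>x. exp (a x) \<le> \<epsilon> * exp (\<delta> * F x) + c"
proof -
  let ?K = "{x. \<delta> * F x - a x \<le> - ln \<epsilon>}"
  have "compact ?K" using G by (auto simp: compact_sublevels_def)
  then have "bounded (F ` ?K)" "bounded ((\<lambda>x. \<delta> * F x - a x) ` ?K)"
    using F G by (auto simp: locally_bounded_def)
  then obtain B1 B2 where B1: "\<And>x. x \<in> ?K \<Longrightarrow> \<bar>F x\<bar> \<le> B1" and B2: "\<And>x. x \<in> ?K \<Longrightarrow> \<bar>\<delta> * F x - a x\<bar> \<le> B2"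
    by (auto simp: bounded_iff)
  have "exp (a x) \<le> \<epsilon> * exp (\<delta> * F x) + exp (\<bar>\<delta>\<bar> * B1 + B2)" for x
  proof (cases "x \<in> ?K")
    case True
    have "\<delta> * F x \<le> \<bar>\<delta>\<bar> * \<bar>F x\<bar>" by (simp flip: abs_mult)
    also have "\<dots> \<le> \<bar>\<delta>\<bar> * B1" using B1[OF True] by (intro mult_left_mono) auto
    finally have "exp (a x) \<le> exp (\<bar>\<delta>\<bar> * B1 + B2)" using B2[OF True] by simp
    then show ?thesis using \<epsilon> by (simp add: add_increasing)
  next
    case False
    then have "exp (a x) \<le> exp (ln \<epsilon> + \<delta> * F x)" by simp
    also have "\<dots> = \<epsilon> * exp (\<delta> * F x)" using \<epsilon> by (simp add: exp_add)
    finally show ?thesis by (simp add: add_increasing2)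
  qed
  then show ?thesis by blast
qed

text \<open>The sub-level sets of \<open>G\<close> exhaust the space, so one of them has positive mass; together with a
  sub-level set of \<open>F\<close> it spans a compact rectangle.\<close>

lemma small_set_of_compact_sublevels:
  fixes F :: "'a::topological_space \<Rightarrow> real" and G :: "'b::topological_space \<Rightarrow> real"
  assumes "prob_space (gibbs N G)" and space: "space N = UNIV" and [measurable]: "G \<in> borel_measurable N"
    and F: "compact_sublevels F" and G: "compact_sublevels G" and W: "locally_bounded (case_prod W)"
  shows "\<exists>B\<in>sets N. 0 < measure (gibbs N G) B \<and> (\<forall>r. \<exists>w. \<forall>x y. F x \<le> r \<longrightarrow> y \<in> B \<longrightarrow> W x y \<le> w)"
proof -
  interpret prob_space "gibbs N G" by fact
  let ?B = "\<lambda>n::nat. {y \<in> space N. G y \<le> real n}"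
  have sets[measurable]: "?B n \<in> sets N" for n by measurable
  have "\<exists>n. 0 < measure (gibbs N G) (?B n)"
  proof (rule ccontr)
    assume "\<not> (\<exists>n. 0 < measure (gibbs N G) (?B n))"
    then have "emeasure (gibbs N G) (?B n) = 0" for n
      using measure_nonneg[of "gibbs N G" "?B n"] by (simp add: emeasure_eq_measure not_less order_antisym)
    then have "emeasure (gibbs N G) (\<Union>n. ?B n) = 0" by (intro emeasure_UN_eq_0) auto
    moreover have "(\<Union>n. ?B n) = space (gibbs N G)" using real_arch_simple by auto
    ultimately show False using emeasure_space_1 by simp
  qed
  then obtain n where n: "0 < measure (gibbs N G) (?B n)" by blast
  have "\<exists>w. \<forall>x y. F x \<le> r \<longrightarrow> y \<in> ?B n \<longrightarrow> W x y \<le> w" for r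
  proof -
    have "compact ({x. F x \<le> r} \<times> {y. G y \<le> real n})"
      using F G by (intro compact_Times) (auto simp: compact_sublevels_def)
    then have "bounded (case_prod W ` ({x. F x \<le> r} \<times> {y. G y \<le> real n}))"
      using W by (simp add: locally_bounded_def)
    then obtain w where "\<And>x y. F x \<le> r \<Longrightarrow> G y \<le> real n \<Longrightarrow> \<bar>W x y\<bar> \<le> w" by (auto simp: bounded_iff)
    then show ?thesis by (intro exI[of _ w]) (force simp: abs_le_iff)
  qed
  with n sets show ?thesis by blast
qed

lemma locally_bounded_swap:
  assumes "locally_bounded (case_prod W)"
  shows "locally_bounded (\<lambda>(y, x). W x y)"
  unfolding locally_bounded_def
proof (intro allI impI)
  fix K assume "compact (K :: ('b \<times> 'a) set)"
  then have "compact (prod.swap ` K)" by (intro compact_continuous_image continuous_intros)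
  then have "bounded (case_prod W ` prod.swap ` K)" using assms by (simp add: locally_bounded_def)
  then show "bounded ((\<lambda>(y, x). W x y) ` K)" by (simp add: image_image case_prod_beta')
qed

text \<open>If \<open>W\<close> is bounded below everywhere, its infimum provides \<open>C\<close> and nothing has to be removed. Otherwise
  the sections of the exceptional null set of the product measure are null outside null sets.\<close>

lemma exceptional_sets:
  assumes "sigma_finite_measure M" "sigma_finite_measure N"
    and W[measurable]: "case_prod W \<in> borel_measurable (M \<Otimes>\<^sub>M N)"
    and "\<exists>C. AE z in M \<Otimes>\<^sub>M N. exp (- case_prod W z) \<le> C"
  shows "\<exists>(C::real) NX NY. 0 < C \<and> NX \<in> null_sets M \<and> NY \<in> null_sets N \<and>
    (\<forall>x. x \<notin> NX \<longrightarrow> (x \<in> space M \<longrightarrow> (AE y in N. exp (- W x y) \<le> C))) \<and>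
    (\<forall>y. y \<notin> NY \<longrightarrow> (y \<in> space N \<longrightarrow> (AE x in M. exp (- W x y) \<le> C))) \<and>
    (bdd_below (range (case_prod W)) \<longrightarrow> NX = {} \<and> NY = {})"
proof (cases "bdd_below (range (case_prod W))")
  case True
  then obtain m where m: "\<And>x y. m \<le> W x y" by (force simp: bdd_below_def)
  then have "exp (- W x y) \<le> exp (- m)" for x y by simp
  then show ?thesis by (intro exI[of _ "exp (- m)"] exI[of _ "{}"]) auto
next
  case False
  interpret M: sigma_finite_measure M by fact
  interpret N: sigma_finite_measure N by fact
  interpret pair_sigma_finite M N ..
  obtain C0 where C0: "AE z in M \<Otimes>\<^sub>M N. exp (- case_prod W z) \<le> C0" using assms by blast
  define C where "C = max C0 1"
  have C: "AE z in M \<Otimes>\<^sub>M N. exp (- W (fst z) (snd z)) \<le> C"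
    using C0 by eventually_elim (auto simp: C_def case_prod_beta')
  have [measurable]: "(\<lambda>z. W (fst z) (snd z)) \<in> borel_measurable (M \<Otimes>\<^sub>M N)"
    using W by (simp add: case_prod_beta')
  have X: "AE x in M. AE y in N. exp (- W x y) \<le> C" using AE_pair[OF C] by simp
  moreover have "AE y in N. AE x in M. exp (- W x y) \<le> C"
    using AE_commute[of "\<lambda>x y. exp (- W x y) \<le> C"] X by simp
  ultimately obtain NX NY where "NX \<in> null_sets M" "{x \<in> space M. \<not> (AE y in N. exp (- W x y) \<le> C)} \<subseteq> NX"
    "NY \<in> null_sets N" "{y \<in> space N. \<not> (AE x in M. exp (- W x y) \<le> C)} \<subseteq> NY"
    by (auto simp: eventually_ae_filter)
  then show ?thesis using False by (intro exI[of _ C] exI[of _ NX] exI[of _ NY]) (auto simp: C_def)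
qed

lemma kernel_R_eq: "kernel_R lam W = kernel_Q lam (\<lambda>y x. W x y)"
  by (simp add: kernel_R_def kernel_Q_def fun_eq_iff)

lemma cost_U_eq: "cost_U lam U W = cost_V lam U (\<lambda>y x. W x y)"
  by (simp add: cost_U_def cost_V_def fun_eq_iff)

lemma sinkhorn_even_eq: "sinkhorn_even lam nu U V W n = gibbs_kernel nu W (pot_V lam nu U V W (2 * n))"
  by (simp add: sinkhorn_even_def gibbs_kernel_def fun_eq_iff)

lemma sinkhorn_odd_eq:
  "sinkhorn_odd lam nu U V W n = gibbs_kernel lam (\<lambda>y x. W x y) (pot_U lam nu U V W (2 * n))"
  using pot_U_odd[of lam nu U V W n] by (simp add: sinkhorn_odd_def gibbs_kernel_def fun_eq_iff kernel_R_eq)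

theorem theorem4p8:
  fixes lam :: "'a::polish_space measure" and nu :: "'b::polish_space measure"
    and U :: "'a \<Rightarrow> real" and V :: "'b \<Rightarrow> real" and W :: "'a \<Rightarrow> 'b \<Rightarrow> real" and \<delta> :: real
  assumes "locally compact (UNIV :: 'a set)" and "locally compact (UNIV :: 'b set)"
    and "sets lam = sets borel" and "sets nu = sets borel"
    and "finite_on_compacts lam" and "finite_on_compacts nu"
    and "U \<in> borel_measurable borel" and "V \<in> borel_measurable borel"
    and "case_prod W \<in> borel_measurable (borel \<Otimes>\<^sub>M borel)"
    and "prob_space (gibbs lam U)" and "prob_space (gibbs nu V)"
    and "\<And>x. prob_space (kernel_Q nu W x)"
    and "\<exists>P. coupling (gibbs lam U) (gibbs nu V) P \<and>
             finite_rel_entropy P (kjoint (gibbs lam U) (kernel_Q nu W))"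
    and "locally_bounded U" and "locally_bounded V" and "locally_bounded (case_prod W)"
    and "\<exists>C. AE z in lam \<Otimes>\<^sub>M nu. exp (- case_prod W z) \<le> C"
    and "compact_sublevels U" and "compact_sublevels V"
    and "0 < \<delta>" and "\<delta> \<le> 1"
    and "cond_H lam nu U V W \<delta>"
  defines "\<phi> \<equiv> \<lambda>x. exp (\<delta> * (U x - (INF x'. U x')))"
    and "\<psi> \<equiv> \<lambda>y. exp (\<delta> * (V y - (INF y'. V y')))"
  shows "bdd_below (range U) \<and> bdd_below (range V) \<and>
    (\<exists>N\<in>null_sets lam. \<exists>N'\<in>null_sets nu.
       (bdd_below (range (case_prod W)) \<longrightarrow> N = {} \<and> N' = {}) \<and>
       cond_D (sinkhorn_even lam nu U V W) (sinkhorn_odd lam nu U V W) \<phi> \<psi> 1 N N') \<and>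
    (\<exists>\<rho> c. 0 \<le> \<rho> \<and> \<rho> < 1 \<and> 0 < c \<and>
       (\<forall>n\<ge>1. absolutely_continuous (gibbs nu V) (pi_even lam nu U V W n) \<and>
               absolutely_continuous (gibbs lam U) (pi_odd lam nu U V W n) \<and>
               max (wnorm (gibbs nu V) \<psi> (log_density (gibbs nu V) (pi_even lam nu U V W n)))
                   (wnorm (gibbs lam U) \<phi> (log_density (gibbs lam U) (pi_odd lam nu U V W n)))
                 \<le> ereal (c * \<rho> ^ (2 * n))))"
proof -
  have U_lam: "U \<in> borel_measurable lam" and V_nu: "V \<in> borel_measurable nu"
    using assms(7,8) unfolding measurable_cong_sets[OF assms(3) refl] measurable_cong_sets[OF assms(4) refl] .
  have prod: "sets (lam \<Otimes>\<^sub>M nu) = sets (borel \<Otimes>\<^sub>M borel :: ('a \<times> 'b) measure)"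
    using assms(3,4) by (rule sets_pair_measure_cong)
  have W_meas: "case_prod W \<in> borel_measurable (lam \<Otimes>\<^sub>M nu)"
    using assms(9) unfolding measurable_cong_sets[OF prod refl] .
  have space: "space lam = UNIV" "space nu = UNIV"
    using assms(3,4) by (auto dest: sets_eq_imp_space_eq)
  have bdd: "bdd_below (range U)" "bdd_below (range V)"
    using assms(14,15,18,19) by (auto intro: bdd_below_of_compact_sublevels)
  have sf: "sigma_finite_measure lam" "sigma_finite_measure nu"
    using sigma_finite_of_gibbs[OF U_lam assms(10)] sigma_finite_of_gibbs[OF V_nu assms(11)] .
  obtain C :: real and N N' where C: "0 < C" and null: "N \<in> null_sets lam" "N' \<in> null_sets nu"
    and bound: "\<And>x. x \<notin> N \<Longrightarrow> AE y in nu. exp (- W x y) \<le> C" "\<And>y. y \<notin> N' \<Longrightarrow> AE x in lam. exp (- W x y) \<le> C"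
    and empty: "bdd_below (range (case_prod W)) \<longrightarrow> N = {} \<and> N' = {}"
    using exceptional_sets[OF sf W_meas assms(17)] space by auto
  note H = assms(22)[unfolded cond_H_def cost_U_eq]
  have pair: "cost_pair lam nu U V W C \<delta> N N'"
  proof (rule cost_pair.intro)
    show "\<exists>c. \<forall>x. exp (cost_V nu V W x) \<le> \<epsilon> * exp (\<delta> * U x) + c" if "0 < \<epsilon>" for \<epsilon>
      by (rule exp_growth_of_compact_sublevels[OF assms(14) _ _ that]) (use H in auto)
    show "\<exists>c. \<forall>y. exp (cost_V lam U (\<lambda>y x. W x y) y) \<le> \<epsilon> * exp (\<delta> * V y) + c" if "0 < \<epsilon>" for \<epsilon>
      by (rule exp_growth_of_compact_sublevels[OF assms(15) _ _ that]) (use H in auto)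
    show "\<exists>B\<in>sets nu. 0 < measure (gibbs nu V) B \<and> (\<forall>r. \<exists>w. \<forall>x y. U x \<le> r \<longrightarrow> y \<in> B \<longrightarrow> W x y \<le> w)"
      by (rule small_set_of_compact_sublevels[OF assms(11) space(2) V_nu assms(18,19,16)])
    show "\<exists>B\<in>sets lam. 0 < measure (gibbs lam U) B \<and> (\<forall>r. \<exists>w. \<forall>y x. V y \<le> r \<longrightarrow> x \<in> B \<longrightarrow> W x y \<le> w)"
      by (rule small_set_of_compact_sublevels[OF assms(10) space(1) U_lam assms(19,18) locally_bounded_swap[OF assms(16)]])
    show "(\<integral>\<^sup>+ x. ennreal (exp (cost_V nu V W x)) \<partial>gibbs lam (\<lambda>x. (1 - \<delta>) * U x)) < \<infinity>"
      "(\<integral>\<^sup>+ y. ennreal (exp (cost_V lam U (\<lambda>y x. W x y) y)) \<partial>gibbs nu (\<lambda>y. (1 - \<delta>) * V y)) < \<infinity>"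
      "\<And>x. integrable (gibbs nu V) (\<lambda>y. W x y)" "\<And>y. integrable (gibbs lam U) (\<lambda>x. W x y)"
      using H by (simp_all add: max_less_iff_conj)
  qed (rule space U_lam V_nu W_meas assms(10,11,20) C null bound bdd | assumption)+
  define u where "u n = pot_U lam nu U V W (2 * n)" for n
  define v where "v n = pot_V lam nu U V W (2 * n)" for n
  have v0: "v 0 = (\<lambda>y. 0)" by (simp add: v_def pot_V_def)
  interpret sinkhorn_iteration lam nu U V W C \<delta> N N' u v
  proof (intro sinkhorn_iteration.intro pair sinkhorn_iteration_axioms.intro)
    interpret prob_space "gibbs nu V" by fact
    show "u n = sinkhorn_update nu U W (v n)" for n
      using pot_U_even[OF assms(12), of lam U V n] by (auto simp: u_def v_def sinkhorn_update_def fun_eq_iff)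
    show "v (Suc n) = sinkhorn_update lam V (\<lambda>y x. W x y) (u n)" for n
      using pot_V_even[of lam nu U V W n] pot_V_odd[of lam nu U V W n]
      by (auto simp: u_def v_def sinkhorn_update_def fun_eq_iff kernel_R_eq)
    show "u 0 = U" by (simp add: u_def pot_U_def)
    show "v 0 \<in> borel_measurable nu" "integrable (gibbs nu V) (v 0)" by (simp_all add: v0)
    show "partition_fun nu W (v 0) x < \<infinity>" for x
      by (simp add: v0 kapp_def prob_space.emeasure_space_1[OF assms(12)])
  qed
  define mU where "mU = (INF x'. U x')"
  define mV where "mV = (INF y'. V y')"
  have inf: "mU \<le> U x" "mV \<le> V y" for x y
    using bdd by (auto simp: mU_def mV_def intro: cINF_lower)
  have even: "sinkhorn_even lam nu U V W = (\<lambda>n. gibbs_kernel nu W (v n))"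
    by (simp add: fun_eq_iff sinkhorn_even_eq v_def)
  have odd: "sinkhorn_odd lam nu U V W = (\<lambda>n. gibbs_kernel lam (\<lambda>y x. W x y) (u n))"
    by (simp add: fun_eq_iff sinkhorn_odd_eq u_def)
  have D: "cond_D (sinkhorn_even lam nu U V W) (sinkhorn_odd lam nu U V W) \<phi> \<psi> 1 N N'"
    using condition_D[OF inf] unfolding even odd \<phi>_def \<psi>_def mU_def mV_def .
  obtain \<rho> K where \<rho>: "0 < \<rho>" "\<rho> < 1" and K: "0 < K"
    and decay: "\<And>n y. 1 \<le> n \<Longrightarrow> y \<notin> N' \<Longrightarrow> \<bar>v (Suc n) y - v n y\<bar> \<le> K * \<rho> ^ (2 * n) * \<psi> y"
      "\<And>n x. 1 \<le> n \<Longrightarrow> x \<notin> N \<Longrightarrow> \<bar>u (Suc n) x - u n x\<bar> \<le> K * \<rho> ^ (2 * n) * \<phi> x"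
    using increments_decay[OF inf] unfolding \<phi>_def \<psi>_def mU_def mV_def by blast
  have "absolutely_continuous (gibbs nu V) (pi_even lam nu U V W n) \<and>
      absolutely_continuous (gibbs lam U) (pi_odd lam nu U V W n) \<and>
      max (wnorm (gibbs nu V) \<psi> (log_density (gibbs nu V) (pi_even lam nu U V W n)))
          (wnorm (gibbs lam U) \<phi> (log_density (gibbs lam U) (pi_odd lam nu U V W n)))
        \<le> ereal (K * \<rho> ^ (2 * n))" if n: "1 \<le> n" for n
  proof -
    interpret gU: prob_space "gibbs lam U" by fact
    interpret gV: prob_space "gibbs nu V" by fact
    note [measurable] = potentials_measurable U_lam V_nu
    have Y: "AE y in gibbs nu V. \<bar>v (Suc n) y - v n y\<bar> \<le> K * \<rho> ^ (2 * n) * \<psi> y"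
      unfolding AE_gibbs[OF V_nu] using AE_not_in[OF null(2)] by eventually_elim (rule decay(1)[OF n])
    have X: "AE x in gibbs lam U. \<bar>u (Suc n) x - u n x\<bar> \<le> K * \<rho> ^ (2 * n) * \<phi> x"
      unfolding AE_gibbs[OF U_lam] using AE_not_in[OF null(1)] by eventually_elim (rule decay(2)[OF n])
    have pe: "pi_even lam nu U V W n = density (gibbs nu V) (\<lambda>y. ennreal (exp (v (Suc n) y - v n y)))"
      unfolding pi_even_def even by (rule marginals(1)[OF n])
    have po: "pi_odd lam nu U V W n = density (gibbs lam U) (\<lambda>x. ennreal (exp (u (Suc n) x - u n x)))"
      unfolding pi_odd_def odd by (rule marginals(2)[OF n])
    have "\<psi> \<in> borel_measurable (gibbs nu V)" "\<phi> \<in> borel_measurable (gibbs lam U)"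
      unfolding \<phi>_def \<psi>_def by measurable
    then show ?thesis
      using wnorm_log_density_le[OF gV.sigma_finite_measure_axioms pe _ _ _ Y]
        wnorm_log_density_le[OF gU.sigma_finite_measure_axioms po _ _ _ X]
      by (simp add: \<phi>_def \<psi>_def)
  qed
  then show ?thesis
    using bdd null empty D \<rho> K by (intro conjI bexI[of _ N] bexI[of _ N'] exI[of _ \<rho>] exI[of _ K]) auto
qed

end
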